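(* Let $p_0,p_1,p_2\in R_{2,1}$ have no common zeros on $\mathbb{P}^1\times\mathbb{P}^1$, and let $I=\langle p_0,p_1,p_2\rangle\subset R$. In the non-generic case, the minimal (bigraded) free resolution of the ideal $I$ has the form $$0\to R(-6,-3)\to R(-4,-3)^2\oplus R(-6,-2)^2\to R(-6,-1)\oplus R(-4,-2)^3\oplus R(-2,-3)\to R(-2,-1)^3\to I\to 0.$$
   Context: $k$ is an algebraically closed field and $R=k[x,y,z,w]$ is bigraded with $x,y$ of degree $(1,0)$ and $z,w$ of degree $(0,1)$; $R_{m,n}$ is the graded piece of degree $(m,n)$ and $R(-a,-b)_{m,n}=R_{m-a,n-b}$. The variables $x,y$ (resp. $z,w$) are homogeneous coordinates on the first (resp. second) factor of $\mathbb{P}^1\times\mathbb{P}^1$. Non-generic case: identify $\mathbb{P}(R_{2,1})$ with $\mathbb{P}^5$. Since $p_0,p_1,p_2$ have no common zeros on $\mathbb{P}^1\times\mathbb{P}^1$ they are linearly independent, so $W(p)=\mathbb{P}(\mathrm{Span}(p_0,p_1,p_2))$ is a plane in $\mathbb{P}^5$. Let $Y\subset\mathbb{P}^5$ be the image of the Segre embedding $\mathbb{P}(R_{2,0})\times\mathbb{P}(R_{0,1})\to\mathbb{P}(R_{2,1})$ given by multiplication of polynomials. The case is generic if $W(p)\cap Y$ is finite, and non-generic if $W(p)\cap Y$ is infinite. *)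

theory Defs
  imports
    "HOL-Library.Poly_Mapping"
    "HOL-Computational_Algebra.Polynomial"
    "Jordan_Normal_Form.Matrix"
begin

text \<open>
  The coefficient field \<open>k\<close> is a type of class \<^class>\<open>alg_closed_field\<close>. The ring
  \<open>R = k[x,y,z,w]\<close> is the monoid algebra of the monomials (exponent functions on the four
  variables) over \<open>k\<close>.
\<close>

datatype var = Vx | Vy | Vz | Vw

type_synonym monom = "var \<Rightarrow>\<^sub>0 nat"
type_synonym 'k bipoly = "monom \<Rightarrow>\<^sub>0 'k"

definition Var :: "var \<Rightarrow> ('k::comm_ring_1) bipoly" where
  "Var v = Poly_Mapping.single (Poly_Mapping.single v 1) 1"

text \<open>The graded piece \<open>R\<^bsub>m,n\<^esub>\<close>, for \<^emph>\<open>integer\<close> degrees; it is zero if \<open>m < 0\<close> or \<open>n < 0\<close>.\<close>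

definition piece :: "int \<Rightarrow> int \<Rightarrow> ('k::comm_ring_1) bipoly set" where
  "piece m n = {p. \<forall>e \<in> Poly_Mapping.keys p.
     int (Poly_Mapping.lookup e Vx + Poly_Mapping.lookup e Vy) = m \<and>
     int (Poly_Mapping.lookup e Vz + Poly_Mapping.lookup e Vw) = n}"

definition eval_at :: "('k::comm_ring_1) bipoly \<Rightarrow> 'k \<times> 'k \<Rightarrow> 'k \<times> 'k \<Rightarrow> 'k" where
  "eval_at p s t = (\<Sum>e \<in> Poly_Mapping.keys p. Poly_Mapping.lookup p e *
     fst s ^ Poly_Mapping.lookup e Vx * snd s ^ Poly_Mapping.lookup e Vy *
     fst t ^ Poly_Mapping.lookup e Vz * snd t ^ Poly_Mapping.lookup e Vw)"

text \<open>Points of \<open>P\<^sup>1 \<times> P\<^sup>1\<close> are given by pairs of nonzero homogeneous coordinate vectors.\<close>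

definition no_common_zeros :: "('k::field) bipoly set \<Rightarrow> bool" where
  "no_common_zeros S \<longleftrightarrow>
     (\<forall>s t. s \<noteq> (0, 0) \<longrightarrow> t \<noteq> (0, 0) \<longrightarrow> (\<exists>p \<in> S. eval_at p s t \<noteq> 0))"

definition ideal_gen :: "('k::comm_ring_1) bipoly set \<Rightarrow> 'k bipoly set" where
  "ideal_gen S = module.span (*) S"


section \<open>Projective spaces of forms and the non-generic case\<close>

definition cmul :: "'k::comm_ring_1 \<Rightarrow> 'k bipoly \<Rightarrow> 'k bipoly" where
  "cmul c p = Poly_Mapping.single 0 c * p"

definition kspan :: "('k::field) bipoly set \<Rightarrow> 'k bipoly set" where
  "kspan S = module.span cmul S"

text \<open>\<open>P(V)\<close> is the set of one-dimensional subspaces of a \<open>k\<close>-space \<open>V\<close> of polynomials.\<close>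

definition proj :: "('k::field) bipoly set \<Rightarrow> 'k bipoly set set" where
  "proj V = {kspan {p} | p. p \<in> V \<and> p \<noteq> 0}"

definition segre_image :: "('k::field) bipoly set set" where
  "segre_image = {kspan {f * g} | f g. f \<in> piece 2 0 \<and> f \<noteq> 0 \<and> g \<in> piece 0 1 \<and> g \<noteq> 0}"

definition nongeneric :: "('k::field) bipoly \<Rightarrow> 'k bipoly \<Rightarrow> 'k bipoly \<Rightarrow> bool" where
  "nongeneric p0 p1 p2 \<longleftrightarrow> infinite (proj (kspan {p0, p1, p2}) \<inter> segre_image)"


section \<open>Bigraded free modules and minimal free resolutions\<close>

text \<open>
  A list \<open>[(a\<^sub>1,b\<^sub>1), \<dots>, (a\<^sub>r,b\<^sub>r)]\<close> of twists stands for the bigraded free module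
  \<open>R(a\<^sub>1,b\<^sub>1) \<oplus> \<dots> \<oplus> R(a\<^sub>r,b\<^sub>r)\<close>, whose underlying module is \<open>R\<^sup>r\<close>; here
  \<open>R(a,b)\<^bsub>m,n\<^esub> = R\<^bsub>m+a,n+b\<^esub>\<close>, so that the summand \<open>R(-a,-b)\<close> is the entry \<open>(-a,-b)\<close>.
\<close>

type_synonym twists = "(int \<times> int) list"

definition free_mod :: "twists \<Rightarrow> ('k::comm_ring_1) bipoly vec set" where
  "free_mod F = carrier_vec (length F)"

definition free_piece :: "twists \<Rightarrow> int \<Rightarrow> int \<Rightarrow> ('k::comm_ring_1) bipoly vec set" where
  "free_piece F m n =
     {v \<in> free_mod F. \<forall>i < length F. v $ i \<in> piece (m + fst (F ! i)) (n + snd (F ! i))}"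

text \<open>\<open>R\<close>-linear maps of bidegree \<open>(0,0)\<close> between free modules, and from a free module to \<open>R\<close>.\<close>

definition bigraded_hom ::
  "twists \<Rightarrow> twists \<Rightarrow> (('k::comm_ring_1) bipoly vec \<Rightarrow> 'k bipoly vec) \<Rightarrow> bool" where
  "bigraded_hom F G f \<longleftrightarrow>
     (\<forall>u \<in> free_mod F. f u \<in> free_mod G) \<and>
     (\<forall>u \<in> free_mod F. \<forall>v \<in> free_mod F. f (u + v) = f u + f v) \<and>
     (\<forall>r. \<forall>u \<in> free_mod F. f (r \<cdot>\<^sub>v u) = r \<cdot>\<^sub>v f u) \<and>
     (\<forall>m n. \<forall>u \<in> free_piece F m n. f u \<in> free_piece G m n)"

definition bigraded_hom_to_ring ::
  "twists \<Rightarrow> (('k::comm_ring_1) bipoly vec \<Rightarrow> 'k bipoly) \<Rightarrow> bool" where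
  "bigraded_hom_to_ring F f \<longleftrightarrow>
     (\<forall>u \<in> free_mod F. \<forall>v \<in> free_mod F. f (u + v) = f u + f v) \<and>
     (\<forall>r. \<forall>u \<in> free_mod F. f (r \<cdot>\<^sub>v u) = r * f u) \<and>
     (\<forall>m n. \<forall>u \<in> free_piece F m n. f u \<in> piece m n)"

definition irrelevant :: "('k::comm_ring_1) bipoly set" where
  "irrelevant = ideal_gen {Var Vx, Var Vy, Var Vz, Var Vw}"

text \<open>
  A finite list \<open>[F\<^sub>0, \<dots>, F\<^sub>l]\<close> of free modules is continued by zero modules. The complex
  \<open>\<dots> \<rightarrow> F\<^sub>2 \<rightarrow> F\<^sub>1 \<rightarrow> F\<^sub>0 \<rightarrow> I \<rightarrow> 0\<close> has differentials \<open>d i : F\<^bsub>i+1\<^esub> \<rightarrow> F\<^sub>i\<close> and augmentation \<open>aug\<close>.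
  It is exact everywhere (at the last nonzero module, exactness is injectivity of the last
  nonzero differential), and it is minimal: the image of every \<open>d i\<close> lies in \<open>(x,y,z,w) F\<^sub>i\<close>.
\<close>

definition res_term :: "twists list \<Rightarrow> nat \<Rightarrow> twists" where
  "res_term Fs i = (if i < length Fs then Fs ! i else [])"

definition bigraded_free_resolution ::
  "('k::comm_ring_1) bipoly set \<Rightarrow> twists list \<Rightarrow> ('k bipoly vec \<Rightarrow> 'k bipoly) \<Rightarrow>
   (nat \<Rightarrow> 'k bipoly vec \<Rightarrow> 'k bipoly vec) \<Rightarrow> bool" where
  "bigraded_free_resolution I Fs aug d \<longleftrightarrow>
     bigraded_hom_to_ring (res_term Fs 0) aug \<and>
     (\<forall>i. bigraded_hom (res_term Fs (Suc i)) (res_term Fs i) (d i)) \<and>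
     aug ` free_mod (res_term Fs 0) = I \<and>
     {v \<in> free_mod (res_term Fs 0). aug v = 0} = d 0 ` free_mod (res_term Fs 1) \<and>
     (\<forall>i. {v \<in> free_mod (res_term Fs (Suc i)). d i v = 0\<^sub>v (length (res_term Fs i))} =
          d (Suc i) ` free_mod (res_term Fs (Suc (Suc i))))"

definition minimal_bigraded_free_resolution ::
  "('k::comm_ring_1) bipoly set \<Rightarrow> twists list \<Rightarrow> ('k bipoly vec \<Rightarrow> 'k bipoly) \<Rightarrow>
   (nat \<Rightarrow> 'k bipoly vec \<Rightarrow> 'k bipoly vec) \<Rightarrow> bool" where
  "minimal_bigraded_free_resolution I Fs aug d \<longleftrightarrow>
     bigraded_free_resolution I Fs aug d \<and>
     (\<forall>i. \<forall>v \<in> free_mod (res_term Fs (Suc i)). \<forall>j < length (res_term Fs i).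
        d i v $ j \<in> irrelevant)"

end

(*
  A point of the plane spanned by the p_i on the Segre variety is a product f g of a quadric in x,
  y and a linear form in z, w. Two distinct such points have independent factors g, since
  otherwise the p_i would have a common zero. Take four of them; rescaling so that g3 = g1 + g2
  and comparing with the fourth shows that f3 is a combination of f1 and f2 with nonzero
  coefficients. Hence the plane is that of the conic (s u + t v) (s z + t w), that is, it is
  spanned by u z, u w + v z and v w for two quadrics u, v in x, y, which have no common zero. For
  this ideal the resolution is explicit: the first syzygies are (v^2, -u v, u^2), the Koszul
  syzygies and (w^2, -z w, z^2). Exactness only uses that z, w and u, v are regular sequences and
  that R is the direct sum of k[x, y] and (z, w); u, v is regular because (u, v) contains x^3 and
  y^3, by the resultant.
*)
theory Submission
  imports Defs
begin

section \<open>The polynomial ring\<close>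

text \<open>The generators u z, u w + v z, v w all vanish on x = y = 0 and on z = w = 0, which has
  codimension 2 in affine space, so their Koszul complex is not exact. The extra syzygies are read
  off the conic: s^2 u z + s t (u w + v z) + t^2 v w is zero for (s, t) = (v, -u) and for (s, t) =
  (w, -z). Four points suffice in place of a curve. Scaling brings g1, g2, g3 to the form g3 = g1 +
  g2, and g4 = c g1 + d g2 then carries a cross-ratio c/d different from 0, 1 and infinity.
  Expanding the fourth point in the first three gives two formulas for f4, and c different from d
  makes their comparison a relation that expresses f3. Common zeros enter through common factors. If
  two independent members of the plane share a factor f or g, that factor vanishes on a line of a
  ruling; a third generator restricts there to a form in one pair of variables, which has a root
  because k is algebraically closed.\<close>

text \<open>Polynomial mappings form an integral domain only over linearly ordered exponents.\<close>

instantiation var :: linorder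
begin

definition var_index :: "var \<Rightarrow> nat" where
  "var_index v = (case v of Vx \<Rightarrow> 0 | Vy \<Rightarrow> 1 | Vz \<Rightarrow> 2 | Vw \<Rightarrow> 3)"

definition less_eq_var :: "var \<Rightarrow> var \<Rightarrow> bool" where
  "less_eq_var a b \<longleftrightarrow> var_index a \<le> var_index b"

definition less_var :: "var \<Rightarrow> var \<Rightarrow> bool" where
  "less_var a b \<longleftrightarrow> var_index a < var_index b"

instance
  by standard (auto simp: less_eq_var_def less_var_def var_index_def split: var.splits)

end

abbreviation (input) X :: "('k::comm_ring_1) bipoly" where "X \<equiv> Var Vx"
abbreviation (input) Y :: "('k::comm_ring_1) bipoly" where "Y \<equiv> Var Vy"
abbreviation (input) Z :: "('k::comm_ring_1) bipoly" where "Z \<equiv> Var Vz"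
abbreviation (input) W :: "('k::comm_ring_1) bipoly" where "W \<equiv> Var Vw"

abbreviation (input) C :: "('k::comm_ring_1) \<Rightarrow> 'k bipoly" where "C c \<equiv> Poly_Mapping.single 0 c"

lemma bipoly_sum_monomials: "(p::('k::comm_ring_1) bipoly) =
    (\<Sum>e\<in>Poly_Mapping.keys p. Poly_Mapping.single e (Poly_Mapping.lookup p e))"
  by (rule poly_mapping_eqI)
     (simp add: lookup_sum lookup_single when_def if_distrib sum.delta in_keys_iff cong: if_cong)

lemma Var_power: "(Var v :: ('k::comm_ring_1) bipoly) ^ n = Poly_Mapping.single (Poly_Mapping.single v n) 1"
  by (induction n) (simp_all add: Var_def mult_single flip: single_add single_one)

lemma monom_split: "(e::monom) = Poly_Mapping.single Vx (Poly_Mapping.lookup e Vx)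
   + Poly_Mapping.single Vy (Poly_Mapping.lookup e Vy)
   + Poly_Mapping.single Vz (Poly_Mapping.lookup e Vz)
   + Poly_Mapping.single Vw (Poly_Mapping.lookup e Vw)"
proof (rule poly_mapping_eqI)
  show "Poly_Mapping.lookup e v = Poly_Mapping.lookup (Poly_Mapping.single Vx (Poly_Mapping.lookup e Vx)
   + Poly_Mapping.single Vy (Poly_Mapping.lookup e Vy)
   + Poly_Mapping.single Vz (Poly_Mapping.lookup e Vz)
   + Poly_Mapping.single Vw (Poly_Mapping.lookup e Vw)) v" for v
    by (cases v) (simp_all add: lookup_add lookup_single)
qed

lemma single_eq_Vars: "(Poly_Mapping.single e c :: ('k::comm_ring_1) bipoly) =
  C c * X ^ Poly_Mapping.lookup e Vx * Y ^ Poly_Mapping.lookup e Vy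
      * Z ^ Poly_Mapping.lookup e Vz * W ^ Poly_Mapping.lookup e Vw"
  by (subst monom_split[of e]) (simp add: Var_power mult_single)

text \<open>R is generated as a ring by k and the variables. This serves for congruences modulo a
  variable and for identities between substitutions.\<close>

lemma bipoly_induct [case_names const Var add mult]:
  fixes p :: "('k::comm_ring_1) bipoly"
  assumes const: "\<And>c. P (C c)" and Var: "\<And>v. P (Var v)"
    and add: "\<And>p q. P p \<Longrightarrow> P q \<Longrightarrow> P (p + q)" and mult: "\<And>p q. P p \<Longrightarrow> P q \<Longrightarrow> P (p * q)"
  shows "P p"
proof -
  have zero: "P 0" and one: "P 1" using const[of 0] const[of 1] by simp_all
  have pow: "P (Var v ^ n)" for v n by (induction n) (simp_all add: one Var mult)
  have mono: "P (Poly_Mapping.single e c)" for e c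
    unfolding single_eq_Vars[of e c] by (intro mult const pow)
  have "P (\<Sum>e\<in>A. Poly_Mapping.single e (Poly_Mapping.lookup p e))" if "finite A" for A
    using that by (induction A rule: finite_induct) (simp_all add: zero add mono)
  then show ?thesis by (subst bipoly_sum_monomials) simp
qed

section \<open>Evaluation and substitution homomorphisms\<close>

text \<open>The coefficient map \<open>h\<close> is a parameter so that one construction covers
  evaluation in k (\<open>h\<close> the identity) and substitution in R (\<open>h\<close> the
  embedding of constants).\<close>

definition insertion :: "('k \<Rightarrow> 'a) \<Rightarrow> (var \<Rightarrow> 'a) \<Rightarrow> ('k::comm_ring_1) bipoly \<Rightarrow> 'a::comm_ring_1" where
  "insertion h \<phi> p = (\<Sum>e \<in> Poly_Mapping.keys p. h (Poly_Mapping.lookup p e) *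
     \<phi> Vx ^ Poly_Mapping.lookup e Vx * \<phi> Vy ^ Poly_Mapping.lookup e Vy *
     \<phi> Vz ^ Poly_Mapping.lookup e Vz * \<phi> Vw ^ Poly_Mapping.lookup e Vw)"

locale coeff_hom =
  fixes h :: "('k::comm_ring_1) \<Rightarrow> 'a::comm_ring_1"
  assumes h_add: "h (a + b) = h a + h b" and h_mult: "h (a * b) = h a * h b"
    and h_one: "h 1 = 1"
begin

lemma h_zero: "h 0 = 0" using h_add[of 0 0] by simp

text \<open>Cancellation makes the support of p + q smaller than the union of the supports;
  additivity needs all three sums over one common index set.\<close>

lemma insertion_superset:
  assumes "finite A" "Poly_Mapping.keys p \<subseteq> A"
  shows "insertion h \<phi> p = (\<Sum>e \<in> A. h (Poly_Mapping.lookup p e) *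
     \<phi> Vx ^ Poly_Mapping.lookup e Vx * \<phi> Vy ^ Poly_Mapping.lookup e Vy *
     \<phi> Vz ^ Poly_Mapping.lookup e Vz * \<phi> Vw ^ Poly_Mapping.lookup e Vw)"
  unfolding insertion_def using assms
  by (intro sum.mono_neutral_left) (auto simp: in_keys_iff h_zero)

lemma insertion_add: "insertion h \<phi> (p + q) = insertion h \<phi> p + insertion h \<phi> q"
  unfolding insertion_superset[OF finite_UnI[OF finite_keys finite_keys] keys_add, of \<phi> p q]
    insertion_superset[OF finite_UnI[OF finite_keys finite_keys] Un_upper1, of \<phi> p q]
    insertion_superset[OF finite_UnI[OF finite_keys finite_keys] Un_upper2, of \<phi> q p]
  by (simp add: lookup_add h_add algebra_simps sum.distrib)

lemma insertion_zero: "insertion h \<phi> 0 = 0" by (simp add: insertion_def)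

lemma insertion_sum: "insertion h \<phi> (sum f A) = (\<Sum>a\<in>A. insertion h \<phi> (f a))"
  by (induction A rule: infinite_finite_induct) (simp_all add: insertion_zero insertion_add)

lemma insertion_single: "insertion h \<phi> (Poly_Mapping.single e c) = h c *
     \<phi> Vx ^ Poly_Mapping.lookup e Vx * \<phi> Vy ^ Poly_Mapping.lookup e Vy *
     \<phi> Vz ^ Poly_Mapping.lookup e Vz * \<phi> Vw ^ Poly_Mapping.lookup e Vw"
  by (cases "c = 0") (simp_all add: insertion_def h_zero)

lemma insertion_mult: "insertion h \<phi> (p * q) = insertion h \<phi> p * insertion h \<phi> q"
proof -
  have s: "insertion h \<phi> (Poly_Mapping.single e c * Poly_Mapping.single e' c') =
     insertion h \<phi> (Poly_Mapping.single e c) * insertion h \<phi> (Poly_Mapping.single e' c')" for e c e' c'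
    by (simp add: insertion_single mult_single h_mult lookup_add power_add algebra_simps)
  have "insertion h \<phi> (sum f A * sum g B) = insertion h \<phi> (sum f A) * insertion h \<phi> (sum g B)"
    if "f = (\<lambda>e. Poly_Mapping.single e (Poly_Mapping.lookup p e))"
       "g = (\<lambda>e. Poly_Mapping.single e (Poly_Mapping.lookup q e))" for f g A B
    unfolding that by (simp only: sum_product insertion_sum s)
  from this[OF refl refl, of "Poly_Mapping.keys p" "Poly_Mapping.keys q"] show ?thesis
    by (simp flip: bipoly_sum_monomials)
qed

lemma insertion_C: "insertion h \<phi> (C c) = h c"
  by (simp add: insertion_single)

lemma insertion_one: "insertion h \<phi> 1 = 1"
  using insertion_C[of \<phi> 1] by (simp add: h_one)

lemma insertion_Var: "insertion h \<phi> (Var v) = \<phi> v"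
  unfolding Var_def by (cases v) (simp_all add: insertion_single h_one lookup_single)

lemma insertion_minus: "insertion h \<phi> (- p) = - insertion h \<phi> p"
  using insertion_add[of \<phi> p "- p"] by (simp add: insertion_zero add_eq_0_iff)

lemma insertion_diff: "insertion h \<phi> (p - q) = insertion h \<phi> p - insertion h \<phi> q"
  using insertion_add[of \<phi> p "- q"] by (simp add: insertion_minus)

lemma insertion_power: "insertion h \<phi> (p ^ n) = insertion h \<phi> p ^ n"
  by (induction n) (simp_all add: insertion_one insertion_mult)

lemmas insertion_simps = insertion_add insertion_mult insertion_C insertion_Var insertion_one insertion_zero insertion_minus
  insertion_diff insertion_power

end

interpretation id_hom: coeff_hom "\<lambda>c::'k::comm_ring_1. c"
  by standard simp_all

interpretation C_hom: coeff_hom "Poly_Mapping.single 0 :: 'k::comm_ring_1 \<Rightarrow> 'k bipoly"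
  by standard (simp_all add: single_add mult_single)

lemma eval_at_insertion:
  "eval_at p s t = insertion (\<lambda>c. c) (case_var (fst s) (snd s) (fst t) (snd t)) p"
  by (simp add: eval_at_def insertion_def)

lemmas eval_at_simps = id_hom.insertion_simps[of "case_var (fst s) (snd s) (fst t) (snd t)" for s t,
  folded eval_at_insertion]

section \<open>Setting variables to zero\<close>

text \<open>The quotient of R by the variables in \<open>S\<close>, realised as a retraction of R
  onto the polynomials free of them. For \<open>S\<close> = {z, w} the image is k[x, y], so
  reductions modulo (z, w) stay elements of R.\<close>

definition kill :: "var set \<Rightarrow> ('k::comm_ring_1) bipoly \<Rightarrow> 'k bipoly" where
  "kill S = insertion (Poly_Mapping.single 0) (\<lambda>v. if v \<in> S then 0 else Var v)"

lemma kill_simps [simp]: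
  "kill S (p + q) = kill S p + kill S q" "kill S (p * q) = kill S p * kill S q"
  "kill S (C c) = C c" "kill S (Var v) = (if v \<in> S then 0 else Var v)"
  "kill S 1 = 1" "kill S 0 = 0" "kill S (- p) = - kill S p" "kill S (p - q) = kill S p - kill S q"
  "kill S (p ^ n) = kill S p ^ n"
  by (simp_all add: kill_def C_hom.insertion_simps)

lemma Var_dvd_diff_kill: "Var v dvd p - kill {v} p"
proof (induction p rule: bipoly_induct)
  case (mult p q)
  have "p * q - kill {v} (p * q) = p * (q - kill {v} q) + (p - kill {v} p) * kill {v} q"
    by (simp add: algebra_simps)
  then show ?case using mult by (simp only: dvd_add dvd_mult dvd_mult2)
next
  case (add p q)
  have "p + q - kill {v} (p + q) = (p - kill {v} p) + (q - kill {v} q)" by simp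
  then show ?case using add by (simp only: dvd_add)
qed auto

lemma kill_single:
  obtains q where "p = kill {v} p + Var v * q"
  using Var_dvd_diff_kill[of v p] unfolding dvd_def by (metis add.commute diff_add_cancel)

lemma kill_compose: "kill S (kill T p) = kill (S \<union> T) p"
  by (induction p rule: bipoly_induct) auto

text \<open>For z and w this is the decomposition R = k[x, y] + (z, w), obtained by splitting off
  one variable at a time.\<close>

lemma kill_two:
  obtains q r where "p = kill {a, b} p + Var a * q + Var b * r"
proof -
  obtain q where q: "p = kill {a} p + Var a * q" by (rule kill_single)
  obtain r where r: "kill {a} p = kill {b} (kill {a} p) + Var b * r" by (rule kill_single)
  have "kill {b} (kill {a} p) = kill {a, b} p" by (simp add: kill_compose insert_commute)
  with q r have "p = kill {a, b} p + Var a * q + Var b * r"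
    by (metis add.commute add.left_commute)
  then show ?thesis by (rule that)
qed

lemma Var_nonzero [simp]: "(Var a :: ('k::comm_ring_1) bipoly) \<noteq> 0"
  unfolding Var_def by (metis lookup_single_eq lookup_zero zero_neq_one)

text \<open>Since \<open>kill\<close> is a ring homomorphism into a domain, this turns divisibility
  by a variable into an equation that simplification can solve; primality of the variables comes for
  free.\<close>

lemma Var_dvd_iff: "Var a dvd p \<longleftrightarrow> kill {a} p = 0"
proof
  assume "kill {a} p = 0"
  then show "Var a dvd p" using Var_dvd_diff_kill[of a p] by simp
qed (auto elim!: dvdE)

lemma Var_dvd_mult_power:
  fixes p :: "('k::idom) bipoly"
  assumes "a \<noteq> b" "Var a dvd Var b ^ n * p"
  shows "Var a dvd p"
  using assms by (simp add: Var_dvd_iff)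

text \<open>Distinct variables have coprime powers: one factor \<open>Var a\<close> is stripped off
  p and cancelled at a time.\<close>

lemma Var_power_dvd_mult_power:
  fixes p :: "('k::idom) bipoly"
  assumes "a \<noteq> b"
  shows "Var a ^ m dvd Var b ^ n * p \<Longrightarrow> Var a ^ m dvd p"
proof (induction m arbitrary: p)
  case (Suc m)
  then have "Var a dvd Var b ^ n * p" by (auto elim: dvd_mult_left)
  then obtain q where q: "p = Var a * q" using Var_dvd_mult_power[OF assms] by blast
  with Suc.prems have "Var a * Var a ^ m dvd Var a * (Var b ^ n * q)" by (simp add: algebra_simps)
  then have "Var a ^ m dvd Var b ^ n * q" by (metis dvd_mult_cancel_left Var_nonzero)
  then have "Var a ^ m dvd q" by (rule Suc.IH)
  then show ?case by (simp add: q)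
qed simp

section \<open>Graded pieces and their monomial bases\<close>

definition mon :: "nat \<Rightarrow> nat \<Rightarrow> nat \<Rightarrow> nat \<Rightarrow> monom" where
  "mon i j k l = Poly_Mapping.single Vx i + Poly_Mapping.single Vy j
    + Poly_Mapping.single Vz k + Poly_Mapping.single Vw l"

lemma lookup_mon [simp]: "Poly_Mapping.lookup (mon i j k l) Vx = i"
  "Poly_Mapping.lookup (mon i j k l) Vy = j"
  "Poly_Mapping.lookup (mon i j k l) Vz = k"
  "Poly_Mapping.lookup (mon i j k l) Vw = l"
  by (simp_all add: mon_def lookup_add lookup_single)

text \<open>The bidegree fixes the exponents of y and w once those of x and z are chosen, so the
  pairs (i, k) index the monomials without repetition.\<close>

lemma piece_expand:
  assumes "p \<in> piece (int m) (int n)"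
  shows "p = (\<Sum>i\<le>m. \<Sum>k\<le>n. C (Poly_Mapping.lookup p (mon i (m - i) k (n - k)))
     * X ^ i * Y ^ (m - i) * Z ^ k * W ^ (n - k))"
proof -
  let ?g = "\<lambda>(i,k). mon i (m - i) k (n - k)"
  let ?A = "{..m} \<times> {..n}"
  have inj: "inj_on ?g ?A"
  proof (rule inj_onI)
    fix a b assume "a \<in> ?A" "b \<in> ?A" "?g a = ?g b"
    then have "\<And>v. Poly_Mapping.lookup (?g a) v = Poly_Mapping.lookup (?g b) v" by simp
    from this[of Vx] this[of Vz] show "a = b" by (cases a, cases b) simp
  qed
  have sub: "Poly_Mapping.keys p \<subseteq> ?g ` ?A"
  proof
    fix e assume "e \<in> Poly_Mapping.keys p"
    then have *: "Poly_Mapping.lookup e Vx + Poly_Mapping.lookup e Vy = m"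
      "Poly_Mapping.lookup e Vz + Poly_Mapping.lookup e Vw = n"
      using assms by (auto simp: piece_def simp flip: of_nat_add)
    have "e = mon (Poly_Mapping.lookup e Vx) (Poly_Mapping.lookup e Vy)
                  (Poly_Mapping.lookup e Vz) (Poly_Mapping.lookup e Vw)"
      unfolding mon_def by (rule monom_split)
    also have "\<dots> = ?g (Poly_Mapping.lookup e Vx, Poly_Mapping.lookup e Vz)"
      by (simp flip: *)
    finally show "e \<in> ?g ` ?A" using * by (intro image_eqI[where x = "(Poly_Mapping.lookup e Vx, Poly_Mapping.lookup e Vz)"]) auto
  qed
  have "p = (\<Sum>e\<in>?g ` ?A. Poly_Mapping.single e (Poly_Mapping.lookup p e))"
    by (subst bipoly_sum_monomials, rule sum.mono_neutral_left) (use sub in \<open>auto simp: in_keys_iff\<close>)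
  also have "\<dots> = (\<Sum>a\<in>?A. Poly_Mapping.single (?g a) (Poly_Mapping.lookup p (?g a)))"
    by (simp add: sum.reindex[OF inj])
  also have "\<dots> = (\<Sum>i\<le>m. \<Sum>k\<le>n. Poly_Mapping.single (?g (i,k)) (Poly_Mapping.lookup p (?g (i,k))))"
    by (simp add: sum.cartesian_product case_prod_beta)
  also have "\<dots> = (\<Sum>i\<le>m. \<Sum>k\<le>n. C (Poly_Mapping.lookup p (mon i (m - i) k (n - k)))
     * X ^ i * Y ^ (m - i) * Z ^ k * W ^ (n - k))"
    by (intro sum.cong refl) (subst single_eq_Vars, simp)
  finally show ?thesis .
qed

lemma piece_2_0_cases:
  assumes "f \<in> piece 2 0"
  obtains a b c where "f = C a * X^2 + C b * (X * Y) + C c * Y^2"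
proof -
  have "f = C (Poly_Mapping.lookup f (mon 2 0 0 0)) * X^2 + C (Poly_Mapping.lookup f (mon 1 1 0 0)) * (X * Y)
    + C (Poly_Mapping.lookup f (mon 0 2 0 0)) * Y^2"
    by (rule trans[OF piece_expand[of f 2 0]])
      (use assms in \<open>simp_all add: numeral_2_eq_2 algebra_simps\<close>)
  then show ?thesis by (rule that)
qed

lemma kill_piece_2_0: "f \<in> piece 2 0 \<Longrightarrow> S \<subseteq> {Vz, Vw} \<Longrightarrow> kill S f = f"
  by (erule piece_2_0_cases) auto

lemma piece_0_1_cases:
  assumes "g \<in> piece 0 1"
  obtains a b where "g = C a * Z + C b * W"
proof -
  have "g = C (Poly_Mapping.lookup g (mon 0 0 1 0)) * Z + C (Poly_Mapping.lookup g (mon 0 0 0 1)) * W"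
    by (rule trans[OF piece_expand[of g 0 1]]) (use assms in \<open>simp_all add: algebra_simps\<close>)
  then show ?thesis by (rule that)
qed

lemma piece_0: "0 \<in> piece m n" by (simp add: piece_def)

lemma piece_add: "p \<in> piece m n \<Longrightarrow> q \<in> piece m n \<Longrightarrow> p + q \<in> piece m n"
  unfolding piece_def using keys_add[of p q] by fastforce

lemma piece_uminus: "p \<in> piece m n \<Longrightarrow> - p \<in> piece m n"
  unfolding piece_def by (auto simp: in_keys_iff)

lemma piece_diff: "p \<in> piece m n \<Longrightarrow> q \<in> piece m n \<Longrightarrow> p - q \<in> piece m n"
  using piece_add[OF _ piece_uminus, of p m n q] by simp

lemma piece_mult: "p \<in> piece m n \<Longrightarrow> q \<in> piece m' n' \<Longrightarrow> p * q \<in> piece (m + m') (n + n')"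
  unfolding piece_def using keys_mult[of p q] by (fastforce simp: lookup_add)

lemma piece_mult': "p \<in> piece m n \<Longrightarrow> q \<in> piece m' n' \<Longrightarrow> i = m + m' \<Longrightarrow> j = n + n' \<Longrightarrow>
    p * q \<in> piece i j"
  using piece_mult by blast

lemma piece_sum: "(\<And>a. a \<in> A \<Longrightarrow> f a \<in> piece m n) \<Longrightarrow> sum f A \<in> piece m n"
  by (induction A rule: infinite_finite_induct) (auto simp: piece_0 piece_add)

lemma piece_C: "C c \<in> piece 0 0" by (simp add: piece_def)

lemma piece_Var: "X \<in> piece 1 0" "Y \<in> piece 1 0" "Z \<in> piece 0 1" "W \<in> piece 0 1"
  by (simp_all add: piece_def Var_def lookup_single)

lemma piece_C_mult: "p \<in> piece m n \<Longrightarrow> C c * p \<in> piece m n"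
  using piece_mult[OF piece_C] by fastforce

lemma quadric_in_piece: "C a * X^2 + C b * (X * Y) + C c * Y^2 \<in> piece 2 0"
  unfolding power2_eq_square
  by (intro piece_add piece_C_mult) (rule piece_mult'[OF piece_Var(1) piece_Var(1)]
    piece_mult'[OF piece_Var(1) piece_Var(2)] piece_mult'[OF piece_Var(2) piece_Var(2)]; simp)+

lemma piece_2_1_cases:
  fixes p :: "('k::comm_ring_1) bipoly"
  assumes "p \<in> piece 2 1"
  obtains a b where "a \<in> piece 2 0" "b \<in> piece 2 0" "p = a * Z + b * W"
proof -
  define c where "c i k = C (Poly_Mapping.lookup p (mon i (2 - i) k (1 - k)))" for i k
  define f where "f k = c 2 k * X^2 + c 1 k * (X * Y) + c 0 k * Y^2" for k
  have "f k \<in> piece 2 0" for k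
    unfolding f_def c_def by (rule quadric_in_piece)
  moreover have "p = f 1 * Z + f 0 * W"
    by (rule trans[OF piece_expand[of p 2 1]])
       (use assms in \<open>simp_all add: numeral_2_eq_2 algebra_simps c_def f_def\<close>)
  ultimately show ?thesis using that by blast
qed

section \<open>Two quadrics without a common zero\<close>

text \<open>If a = 0 the point at infinity (1 : 0) is a root; otherwise y = 1 leaves a polynomial of
  positive degree.\<close>

lemma binary_quadric_root:
  fixes a b c :: "'k::alg_closed_field"
  obtains x y where "(x, y) \<noteq> (0, 0)" "a * x^2 + b * (x * y) + c * y^2 = 0"
proof (cases "a = 0")
  case True
  show ?thesis by (rule that[of 1 0]) (simp_all add: True)
next
  case False
  have "degree [:c, b, a:] > 0" using False by simp
  then obtain x where "poly [:c, b, a:] x = 0" using alg_closed_imp_poly_has_root by blast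
  then show ?thesis by (intro that[of x 1]) (simp_all add: algebra_simps power2_eq_square)
qed

text \<open>The vector (t, -s) lies in the kernel of the matrix with rows (a, c) and (b, d), so by
  Cramer's rule the determinant annihilates s and t.\<close>

lemma minor_eq_0:
  fixes a :: "'a::comm_ring"
  assumes "c * s = a * t" "d * s = b * t"
  shows "s * (a * d - b * c) = 0" "t * (a * d - b * c) = 0"
proof -
  have "s * (a * d - b * c) = a * (d * s) - b * (c * s)" by (simp add: algebra_simps)
  then show "s * (a * d - b * c) = 0" by (simp add: assms algebra_simps)
  have "t * (a * d - b * c) = (a * t) * d - (b * t) * c" by (simp add: algebra_simps)
  then show "t * (a * d - b * c) = 0" by (simp add: algebra_simps flip: assms)
qed

text \<open>The difference of the two sides is the resultant in Bezout form. Eliminating x^2,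
  respectively y^2, from the two quadrics leaves y (B x + A y) and x (A x + D y), and A^2 - B D is,
  up to sign, the determinant of the two linear factors. If it vanished, they would have a common
  root.\<close>

lemma binary_quadrics_resultant:
  fixes u0 u1 u2 v0 v1 v2 :: "'k::alg_closed_field"
  assumes "\<And>x y. (x, y) \<noteq> (0, 0) \<Longrightarrow>
      u0 * x^2 + u1 * (x * y) + u2 * y^2 \<noteq> 0 \<or> v0 * x^2 + v1 * (x * y) + v2 * y^2 \<noteq> 0"
  shows "(u0 * v2 - u2 * v0)^2 \<noteq> (u0 * v1 - u1 * v0) * (u1 * v2 - u2 * v1)"
proof
  define A where "A = u0 * v2 - u2 * v0"
  define B where "B = u0 * v1 - u1 * v0"
  define D where "D = u1 * v2 - u2 * v1"
  define U where "U x y = u0 * x^2 + u1 * (x * y) + u2 * y^2" for x y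
  define V where "V x y = v0 * x^2 + v1 * (x * y) + v2 * y^2" for x y
  assume "(u0 * v2 - u2 * v0)^2 = (u0 * v1 - u1 * v0) * (u1 * v2 - u2 * v1)"
  then have res: "A * A = B * D" by (simp add: A_def B_def D_def power2_eq_square)
  have nz: "U x y \<noteq> 0 \<or> V x y \<noteq> 0" if "x \<noteq> 0 \<or> y \<noteq> 0" for x y
    using assms[of x y] that by (auto simp: U_def V_def)
  have i0: "v0 * U x y - u0 * V x y = - (y * (B * x + A * y))" for x y
    by (simp add: U_def V_def A_def B_def D_def algebra_simps power2_eq_square)
  have i2: "v2 * U x y - u2 * V x y = x * (A * x + D * y)" for x y
    by (simp add: U_def V_def A_def B_def D_def algebra_simps power2_eq_square)
  have i1: "v1 * U x y - u1 * V x y = B * x^2 - D * y^2" for x y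
    by (simp add: U_def V_def A_def B_def D_def algebra_simps power2_eq_square)
  \<comment> \<open>At such a point both forms are proportional to their coefficient vectors, so all minors vanish.\<close>
  have minors: "A = 0 \<and> B = 0 \<and> D = 0"
    if "x \<noteq> 0 \<or> y \<noteq> 0" "B * x + A * y = 0" "A * x + D * y = 0" for x y
  proof -
    have "x * (B * x + A * y) - y * (A * x + D * y) = 0" using that by simp
    then have "B * x^2 - D * y^2 = 0" by (simp add: algebra_simps power2_eq_square)
    then have e: "v0 * U x y = u0 * V x y" "v1 * U x y = u1 * V x y" "v2 * U x y = u2 * V x y"
      using i0[of x y] i1[of x y] i2[of x y] that by simp_all
    have "U x y * A = 0" "U x y * B = 0" "U x y * D = 0" "V x y * A = 0" "V x y * B = 0" "V x y * D = 0"
      unfolding A_def B_def D_def using e by (blast intro: minor_eq_0)+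
    then show ?thesis using nz[OF that(1)] by auto
  qed
  \<comment> \<open>The common root of the linear factors is (A, -B); when that vector is zero, (1,
    0) is one.\<close>
  have all0: "A = 0 \<and> B = 0 \<and> D = 0"
  proof (cases "A = 0 \<and> B = 0")
    case True
    then show ?thesis using minors[of 1 0] by auto
  next
    case False
    have "B * A + A * - B = 0" "A * A + D * - B = 0" by (simp_all add: res mult.commute)
    then show ?thesis using False by (intro minors[of A "- B"]) auto
  qed
  \<comment> \<open>With all minors zero the quadrics are proportional: at a root of U the value of
    V is nonzero, which forces U to be the zero form. Then any root of V is a common zero.\<close>
  obtain a b where ab: "(a, b) \<noteq> (0, 0)" "U a b = 0"
    unfolding U_def by (rule binary_quadric_root)
  with nz have Vab: "V a b \<noteq> 0" by auto
  with i0[of a b] i1[of a b] i2[of a b] ab all0 have u: "u0 = 0" "u1 = 0" "u2 = 0" by auto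
  obtain c d where cd: "(c, d) \<noteq> (0, 0)" "V c d = 0"
    unfolding V_def by (rule binary_quadric_root)
  with nz have "U c d \<noteq> 0" by auto
  with u show False by (simp add: U_def)
qed

locale coprime_quadrics =
  fixes u v :: "('k::alg_closed_field) bipoly"
  assumes u_piece: "u \<in> piece 2 0" and v_piece: "v \<in> piece 2 0"
    and no_zero: "\<And>s t. s \<noteq> (0, 0) \<Longrightarrow> eval_at u s t \<noteq> 0 \<or> eval_at v s t \<noteq> 0"
begin

text \<open>Membership in the ideal (u, v).\<close>

definition comb :: "'k bipoly \<Rightarrow> bool" where
  "comb p \<longleftrightarrow> (\<exists>a b. p = a * u + b * v)"

lemma comb_u: "comb u" and comb_v: "comb v"
  unfolding comb_def by (rule exI[of _ 1], rule exI[of _ 0], simp)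
    (rule exI[of _ 0], rule exI[of _ 1], simp)

lemma comb_add: "comb p \<Longrightarrow> comb q \<Longrightarrow> comb (p + q)"
proof -
  assume "comb p" "comb q"
  then obtain a b c d where "p = a * u + b * v" "q = c * u + d * v" by (auto simp: comb_def)
  then have "p + q = (a + c) * u + (b + d) * v" by (simp add: algebra_simps)
  then show ?thesis unfolding comb_def by blast
qed

lemma comb_mult: "comb p \<Longrightarrow> comb (r * p)"
proof -
  assume "comb p"
  then obtain a b where "p = a * u + b * v" by (auto simp: comb_def)
  then have "r * p = (r * a) * u + (r * b) * v" by (simp add: algebra_simps)
  then show ?thesis unfolding comb_def by blast
qed

lemma comb_diff: "comb p \<Longrightarrow> comb q \<Longrightarrow> comb (p - q)"
  using comb_add[of p "(-1) * q"] comb_mult[of q "-1"] by simp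

lemma comb_C_mult: "comb (C c * p) \<Longrightarrow> c \<noteq> 0 \<Longrightarrow> comb p"
  using comb_mult[of "C c * p" "C (inverse c)"] by (simp add: mult_single flip: mult.assoc)

text \<open>Up to the nonzero resultant, x^2 y and x y^2 are combinations of x (A x + D y) and y (B
  x + A y), which lie in (u, v). Subtracting them from x u, x v, y u, y v isolates the
  cubes.\<close>

lemma comb_cubes: "comb (X ^ 3) \<and> comb (Y ^ 3)"
proof -
  obtain u0 u1 u2 where u: "u = C u0 * X^2 + C u1 * (X * Y) + C u2 * Y^2"
    by (rule piece_2_0_cases[OF u_piece])
  obtain v0 v1 v2 where v: "v = C v0 * X^2 + C v1 * (X * Y) + C v2 * Y^2"
    by (rule piece_2_0_cases[OF v_piece])
  define A where "A = u0 * v2 - u2 * v0"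
  define B where "B = u0 * v1 - u1 * v0"
  define D where "D = u1 * v2 - u2 * v1"
  have "A^2 \<noteq> B * D"
    unfolding A_def B_def D_def
  proof (rule binary_quadrics_resultant)
    fix x y :: 'k assume "(x, y) \<noteq> (0, 0)"
    from no_zero[OF this, of "(0,0)"]
    show "u0 * x^2 + u1 * (x * y) + u2 * y^2 \<noteq> 0 \<or> v0 * x^2 + v1 * (x * y) + v2 * y^2 \<noteq> 0"
      by (simp add: u v eval_at_simps)
  qed
  then have R: "A * A - B * D \<noteq> 0" by (simp add: power2_eq_square)
  have CA: "C A = C u0 * C v2 - C u2 * C v0" and CB: "C B = C u0 * C v1 - C u1 * C v0"
    and CD: "C D = C u1 * C v2 - C u2 * C v1"
    by (simp_all add: A_def B_def D_def mult_single single_diff)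
  have CR: "C (A * A - B * D) = C A * C A - C B * C D"
    by (simp add: mult_single single_diff)
  have e1: "Y * (C B * X + C A * Y) = C u0 * v - C v0 * u"
    unfolding CA CB u v by (simp add: algebra_simps power2_eq_square)
  have e2: "X * (C A * X + C D * Y) = C v2 * u - C u2 * v"
    unfolding CA CD u v by (simp add: algebra_simps power2_eq_square)
  have "C (A * A - B * D) * (X * X * Y) = C A * Y * (C v2 * u - C u2 * v) - C D * X * (C u0 * v - C v0 * u)"
    unfolding CR e1[symmetric] e2[symmetric] by (simp add: algebra_simps)
  then have "comb (C (A * A - B * D) * (X * X * Y))"
    by (simp only:) (intro comb_diff comb_mult comb_u comb_v)
  then have xxy: "comb (X * X * Y)" using R by (rule comb_C_mult)
  have "C (A * A - B * D) * (X * Y * Y) = C A * X * (C u0 * v - C v0 * u) - C B * Y * (C v2 * u - C u2 * v)"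
    unfolding CR e1[symmetric] e2[symmetric] by (simp add: algebra_simps)
  then have "comb (C (A * A - B * D) * (X * Y * Y))"
    by (simp only:) (intro comb_diff comb_mult comb_u comb_v)
  then have xyy: "comb (X * Y * Y)" using R by (rule comb_C_mult)
  have "C u0 * X ^ 3 = X * u - C u1 * (X * X * Y) - C u2 * (X * Y * Y)"
    "C v0 * X ^ 3 = X * v - C v1 * (X * X * Y) - C v2 * (X * Y * Y)"
    "C u2 * Y ^ 3 = Y * u - C u1 * (X * Y * Y) - C u0 * (X * X * Y)"
    "C v2 * Y ^ 3 = Y * v - C v1 * (X * Y * Y) - C v0 * (X * X * Y)"
    by (simp_all add: u v algebra_simps power2_eq_square power3_eq_cube)
  then have "comb (C u0 * X ^ 3)" "comb (C v0 * X ^ 3)" "comb (C u2 * Y ^ 3)" "comb (C v2 * Y ^ 3)"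
    by (simp_all only:) (intro comb_diff comb_mult comb_u comb_v xxy xyy)+
  \<comment> \<open>u0 = v0 = 0 would give A = B = 0, and u2 = v2 = 0 would give A = D = 0; either
    way the resultant would vanish.\<close>
  moreover have "u0 \<noteq> 0 \<or> v0 \<noteq> 0" "u2 \<noteq> 0 \<or> v2 \<noteq> 0"
    using R by (auto simp: A_def B_def D_def)
  ultimately show ?thesis using comb_C_mult by blast
qed

lemma v_nonzero: "v \<noteq> 0"
proof
  assume "v = 0"
  obtain a b c where u: "u = C a * X^2 + C b * (X * Y) + C c * Y^2"
    by (rule piece_2_0_cases[OF u_piece])
  obtain x y where "(x, y) \<noteq> (0, 0)" "a * x^2 + b * (x * y) + c * y^2 = 0"
    by (rule binary_quadric_root)
  with no_zero[of "(x, y)" "(0, 0)"] \<open>v = 0\<close> show False by (simp add: u eval_at_simps)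
qed

text \<open>Writing X^3 = p u + q v and replacing u a by -v b shows that v divides X^3 a; likewise v
  divides Y^3 a. The two quotients by v satisfy a relation in which X^3 and Y^3 are coprime, so X^3
  can be cancelled and v divides a.\<close>

lemma regular_uv:
  assumes "u * a + v * b = 0"
  obtains h where "a = v * h" "b = - u * h"
proof -
  from comb_cubes obtain p q p' q' where X3: "X ^ 3 = p * u + q * v" and Y3: "Y ^ 3 = p' * u + q' * v"
    by (auto simp: comb_def)
  have ua: "u * a = - v * b" using assms by (simp add: add_eq_0_iff)
  have Xa: "X ^ 3 * a = v * (q * a - p * b)"
    by (simp add: X3 ring_distribs mult.assoc ua)
  have Ya: "Y ^ 3 * a = v * (q' * a - p' * b)"
    by (simp add: Y3 ring_distribs mult.assoc ua)
  have "v * (X ^ 3 * (q' * a - p' * b)) = v * (Y ^ 3 * (q * a - p * b))"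
    using arg_cong[OF Xa, of "(*) (Y ^ 3)"] arg_cong[OF Ya, of "(*) (X ^ 3)"]
    by (simp only: mult.left_commute)
  then have "X ^ 3 * (q' * a - p' * b) = Y ^ 3 * (q * a - p * b)" using v_nonzero by simp
  then have "X ^ 3 dvd Y ^ 3 * (q * a - p * b)" by (metis dvd_triv_left)
  then have "X ^ 3 dvd q * a - p * b" by (rule Var_power_dvd_mult_power[rotated]) simp
  then obtain h where h: "q * a - p * b = X ^ 3 * h" by blast
  have "X ^ 3 * a = X ^ 3 * (v * h)" unfolding Xa h by (rule mult.left_commute)
  then have a: "a = v * h" by simp
  have "v * (u * h + b) = 0" using assms a by (simp add: algebra_simps)
  then have "b = - u * h" using v_nonzero by (simp add: add_eq_0_iff2)
  with a show ?thesis by (rule that)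
qed

lemma swap: "coprime_quadrics v u"
  using u_piece v_piece no_zero by unfold_locales blast+

lemma u_nonzero: "u \<noteq> 0" by (rule coprime_quadrics.v_nonzero[OF swap])

lemma kill_u [simp]: "S \<subseteq> {Vz, Vw} \<Longrightarrow> kill S u = u" and kill_v [simp]: "S \<subseteq> {Vz, Vw} \<Longrightarrow> kill S v = v"
  using kill_piece_2_0 u_piece v_piece by blast+

end

section \<open>Regular sequences and exactness of the explicit complex\<close>

lemma regular_zw:
  fixes a b :: "('k::idom) bipoly"
  assumes "Z * a + W * b = 0"
  obtains h where "a = W * h" "b = - Z * h"
proof -
  have "kill {Vz} (Z * a + W * b) = 0" using assms by simp
  then have "kill {Vz} b = 0" by simp
  then obtain q where q: "b = Z * q" by (auto simp flip: Var_dvd_iff)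
  have "Z * (a + W * q) = 0" using assms by (simp add: q algebra_simps)
  then have "a = W * (- q)" by (simp add: add_eq_0_iff2)
  then show ?thesis using q by (intro that[of "- q"]) simp_all
qed

lemma in_ideal_zw:
  assumes "kill {Vz, Vw} p = 0"
  obtains q r where "p = Z * q + W * r"
  by (rule kill_two[of p Vz Vw]) (rule that, simp add: assms)

context coprime_quadrics
begin

text \<open>z is a nonzerodivisor modulo (u, v): u and v are free of z, so the parts of a and b free
  of z already form a relation and drop out.\<close>

lemma comb_cancel_z:
  assumes "comb (Z * f)"
  shows "comb f"
proof -
  obtain a b where ab: "Z * f = a * u + b * v" using assms by (auto simp: comb_def)
  obtain a' where a': "a = kill {Vz} a + Z * a'" by (rule kill_single)
  obtain b' where b': "b = kill {Vz} b + Z * b'" by (rule kill_single)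
  have "kill {Vz} (a * u + b * v) = 0" by (simp flip: ab)
  then have *: "kill {Vz} a * u + kill {Vz} b * v = 0" by simp
  have "Z * f = (kill {Vz} a + Z * a') * u + (kill {Vz} b + Z * b') * v"
    using ab a' b' by simp
  also have "\<dots> = (kill {Vz} a * u + kill {Vz} b * v) + Z * (a' * u + b' * v)"
    by (simp add: algebra_simps)
  finally have "f = a' * u + b' * v" by (simp add: *)
  then show ?thesis unfolding comb_def by blast
qed

text \<open>The relation between c2 and c3 is a multiple of the Koszul relation of z, w; the other
  two equations then become divisible by w and z.\<close>

lemma exact_at_F2:
  assumes "Z * c2 + W * c3 = 0" "- W * c0 - v * c2 = 0" "Z * c1 + u * c3 = 0"
  obtains b where "c0 = - v * b" "c1 = u * b" "c2 = W * b" "c3 = - Z * b"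
proof -
  obtain b where b: "c2 = W * b" "c3 = - Z * b" using regular_zw[OF assms(1)] .
  have "W * (c0 + v * b) = 0" using assms(2) by (simp add: b algebra_simps add_eq_0_iff)
  then have c0: "c0 = - v * b" by (simp add: add_eq_0_iff2)
  have "Z * (c1 - u * b) = 0" using assms(3) by (simp add: b algebra_simps)
  then have "c1 = u * b" by simp
  with b c0 show ?thesis by (intro that)
qed

text \<open>Modulo (z, w) the last equation reads u^2 f1 = 0, so f1 lies in (z, w). Modulo (u, v) it
  reads z^2 f2 = 0, so f2 lies in (u, v). These two memberships determine a preimage up to a
  relation among the Koszul syzygies alone.\<close>

lemma exact_at_F1:
  assumes e0: "v * v * f1 + (u * W + v * Z) * g1 + v * W * g2 + W * W * f2 = 0"
    and e1: "- (u * v) * f1 - u * Z * g1 + v * W * g3 - Z * W * f2 = 0"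
    and e2: "u * u * f1 - u * Z * g2 - (u * W + v * Z) * g3 + Z * Z * f2 = 0"
  obtains c0 c1 c2 c3 where "f1 = Z * c2 + W * c3" "g1 = - W * c0 - v * c2"
    "g2 = Z * c0 - W * c1 + u * c2 - v * c3" "g3 = Z * c1 + u * c3" "f2 = u * c0 + v * c1"
proof -
  have "kill {Vz, Vw} (u * u * f1 - u * Z * g2 - (u * W + v * Z) * g3 + Z * Z * f2) = 0"
    using e2 by simp
  then have "kill {Vz, Vw} f1 = 0" using u_nonzero by simp
  then obtain c2 c3 where f1: "f1 = Z * c2 + W * c3" by (rule in_ideal_zw)
  have "Z * (Z * f2) = (u * u * f1 - u * Z * g2 - (u * W + v * Z) * g3 + Z * Z * f2)
      + ((Z * g2 + W * g3 - u * f1) * u + (Z * g3) * v)"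
    by (simp add: algebra_simps)
  then have "Z * (Z * f2) = (Z * g2 + W * g3 - u * f1) * u + (Z * g3) * v"
    by (simp only: e2 add_0)
  then have "comb (Z * (Z * f2))" unfolding comb_def by blast
  then have "comb f2" by (blast dest: comb_cancel_z)
  then obtain c0 c1 where f2: "f2 = u * c0 + v * c1" by (auto simp: comb_def mult.commute)
  \<comment> \<open>What remains after subtracting the image of (c0, c1, c2, c3): its coordinates at
    f1 and f2 are zero.\<close>
  define G1 where "G1 = g1 - (- W * c0 - v * c2)"
  define G2 where "G2 = g2 - (Z * c0 - W * c1 + u * c2 - v * c3)"
  define G3 where "G3 = g3 - (Z * c1 + u * c3)"
  have "(u * W + v * Z) * G1 + v * W * G2 =
      v * v * f1 + (u * W + v * Z) * g1 + v * W * g2 + W * W * f2"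
    unfolding G1_def G2_def f1 f2 by (simp add: algebra_simps)
  with e0 have E0: "(u * W + v * Z) * G1 + v * W * G2 = 0" by simp
  have "u * (Z * G1) + v * (- (W * G3)) =
      - (- (u * v) * f1 - u * Z * g1 + v * W * g3 - Z * W * f2)"
    unfolding G1_def G3_def f1 f2 by (simp add: algebra_simps)
  with e1 have E1: "u * (Z * G1) + v * (- (W * G3)) = 0" by simp
  obtain h1 where h1: "Z * G1 = v * h1" "W * G3 = u * h1"
    using regular_uv[OF E1] by auto
  \<comment> \<open>z and w both divide h1, because v is free of z and u is free of w; this makes
    (G1, G2, G3) a multiple of the second Koszul syzygy.\<close>
  have "kill {Vz} (v * h1) = 0" by (simp flip: h1)
  then have "kill {Vz} h1 = 0" using v_nonzero by simp
  then obtain h2 where h2: "h1 = Z * h2" by (auto simp flip: Var_dvd_iff)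
  have "kill {Vw} (u * h1) = 0" by (simp flip: h1)
  then have "kill {Vw} h2 = 0" using u_nonzero h2 by simp
  then obtain h where h: "h2 = W * h" by (auto simp flip: Var_dvd_iff)
  have "Z * G1 = Z * (v * W * h)" "W * G3 = W * (u * Z * h)"
    using h1 h2 h by (simp_all add: algebra_simps)
  then have G13: "G1 = v * W * h" "G3 = u * Z * h" by simp_all
  have "v * W * (G2 + (u * W + v * Z) * h) = 0"
    using E0 by (simp add: G13 algebra_simps)
  then have G2: "G2 = - ((u * W + v * Z) * h)" using v_nonzero by (simp add: add_eq_0_iff2)
  show ?thesis
  \<comment> \<open>The multiple h of the second Koszul syzygy is the image of (0, 0, -w h, z h),
    whose coordinate at f1 cancels.\<close>
  proof (rule that[of "c2 - W * h" "c3 + Z * h" c0 c1])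
    show "f1 = Z * (c2 - W * h) + W * (c3 + Z * h)" by (simp add: f1 algebra_simps)
    show "f2 = u * c0 + v * c1" by (rule f2)
    have "g1 = G1 - W * c0 - v * c2" by (simp add: G1_def)
    then show "g1 = - W * c0 - v * (c2 - W * h)" by (simp add: G13 algebra_simps)
    have "g2 = G2 + (Z * c0 - W * c1 + u * c2 - v * c3)" by (simp add: G2_def)
    then show "g2 = Z * c0 - W * c1 + u * (c2 - W * h) - v * (c3 + Z * h)"
      by (simp add: G2 algebra_simps)
    have "g3 = G3 + (Z * c1 + u * c3)" by (simp add: G3_def)
    then show "g3 = Z * c1 + u * (c3 + Z * h)" by (simp add: G13 algebra_simps)
  qed
qed

text \<open>Grouped by u and v, the relation is a syzygy of the regular sequence u, v with entries
  that are linear combinations of the a's over z and w. Alternating the regularity of u, v with that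
  of z, w peels off the coefficients one after another.\<close>

lemma exact_at_F0:
  assumes "u * Z * a0 + (u * W + v * Z) * a1 + v * W * a2 = 0"
  obtains f1 g1 g2 g3 f2
  where "a0 = v * v * f1 + (u * W + v * Z) * g1 + v * W * g2 + W * W * f2"
    "a1 = - (u * v) * f1 - u * Z * g1 + v * W * g3 - Z * W * f2"
    "a2 = u * u * f1 - u * Z * g2 - (u * W + v * Z) * g3 + Z * Z * f2"
proof -
  have "u * (Z * a0 + W * a1) + v * (Z * a1 + W * a2) = 0"
    using assms by (simp add: algebra_simps)
  then obtain h where h: "Z * a0 + W * a1 = v * h" "Z * a1 + W * a2 = - u * h"
    by (rule regular_uv)
  have "kill {Vz, Vw} (v * h) = 0" by (simp flip: h(1))
  then have "kill {Vz, Vw} h = 0" using v_nonzero by simp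
  then obtain \<alpha> \<beta> where h': "h = Z * \<alpha> + W * \<beta>" by (rule in_ideal_zw)
  have "Z * (a0 - v * \<alpha>) + W * (a1 - v * \<beta>) = 0" using h(1) by (simp add: h' algebra_simps)
  then obtain \<gamma> where \<gamma>: "a0 - v * \<alpha> = W * \<gamma>" "a1 - v * \<beta> = - Z * \<gamma>" by (rule regular_zw)
  have "Z * (a1 + u * \<alpha>) + W * (a2 + u * \<beta>) = (Z * a1 + W * a2) + u * h"
    by (simp add: h' algebra_simps)
  then have "Z * (a1 + u * \<alpha>) + W * (a2 + u * \<beta>) = 0" by (simp add: h(2))
  then obtain \<delta> where \<delta>: "a1 + u * \<alpha> = W * \<delta>" "a2 + u * \<beta> = - Z * \<delta>" by (rule regular_zw)
  \<comment> \<open>a1 has been computed twice. Comparing the results and reducing modulo (z, w)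
    gives a syzygy of u, v, whose multiplier \<epsilon> is the coefficient of (v^2, -u v,
    u^2).\<close>
  have "u * \<alpha> = W * \<delta> - a1" "v * \<beta> = a1 + Z * \<gamma>"
    using \<gamma>(2) \<delta>(1) by (simp_all add: algebra_simps)
  then have eq: "u * \<alpha> + v * \<beta> = Z * \<gamma> + W * \<delta>" by simp
  have "kill {Vz, Vw} (u * \<alpha> + v * \<beta>) = 0" unfolding eq by simp
  then have "u * kill {Vz, Vw} \<alpha> + v * kill {Vz, Vw} \<beta> = 0" by simp
  then obtain \<epsilon> where \<epsilon>: "kill {Vz, Vw} \<alpha> = v * \<epsilon>" "kill {Vz, Vw} \<beta> = - u * \<epsilon>" by (rule regular_uv)
  obtain \<alpha>1 \<alpha>2 where \<alpha>: "\<alpha> = v * \<epsilon> + Z * \<alpha>1 + W * \<alpha>2" unfolding \<epsilon>(1)[symmetric] by (rule kill_two)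
  obtain \<beta>1 \<beta>2 where \<beta>: "\<beta> = - u * \<epsilon> + Z * \<beta>1 + W * \<beta>2" unfolding \<epsilon>(2)[symmetric] by (rule kill_two)
  \<comment> \<open>The \<epsilon> terms cancel, and the rest is a syzygy of z, w. Its multiplier
    \<eta> is, up to sign, the coefficient of (w^2, -z w, z^2).\<close>
  have "Z * (u * \<alpha>1 + v * \<beta>1 - \<gamma>) + W * (u * \<alpha>2 + v * \<beta>2 - \<delta>)
      = (u * \<alpha> + v * \<beta>) - (Z * \<gamma> + W * \<delta>)"
    unfolding \<alpha> \<beta> by (simp add: algebra_simps)
  then have "Z * (u * \<alpha>1 + v * \<beta>1 - \<gamma>) + W * (u * \<alpha>2 + v * \<beta>2 - \<delta>) = 0"
    unfolding eq by simp
  then obtain \<eta> where "u * \<alpha>1 + v * \<beta>1 - \<gamma> = W * \<eta>" "u * \<alpha>2 + v * \<beta>2 - \<delta> = - Z * \<eta>"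
    by (rule regular_zw)
  then have \<gamma>': "\<gamma> = u * \<alpha>1 + v * \<beta>1 - W * \<eta>" and \<delta>': "\<delta> = u * \<alpha>2 + v * \<beta>2 + Z * \<eta>"
    by (simp_all add: algebra_simps)
  have "a0 = (a0 - v * \<alpha>) + v * \<alpha>" "a1 = (a1 - v * \<beta>) + v * \<beta>" "a2 = (a2 + u * \<beta>) - u * \<beta>"
    by simp_all
  then have a: "a0 = v * \<alpha> + W * \<gamma>" "a1 = v * \<beta> - Z * \<gamma>" "a2 = - u * \<beta> - Z * \<delta>"
    unfolding \<gamma> \<delta> by simp_all
  show ?thesis
    by (rule that[of \<epsilon> \<alpha>1 "\<alpha>2 + \<beta>1" "- \<eta>" \<beta>2]; unfold a \<alpha> \<beta> \<gamma>' \<delta>'; simp add: algebra_simps)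
qed

end

section \<open>The resolution\<close>

lemma module_mult: "Modules.module ((*) :: 'a::comm_ring_1 \<Rightarrow> 'a \<Rightarrow> 'a)"
  by standard (simp_all add: algebra_simps)

lemma ideal_gen_triple: "x \<in> ideal_gen {p, q, r} \<longleftrightarrow> (\<exists>a b c. x = a * p + b * q + c * r)"
  unfolding ideal_gen_def module.span_breakdown_eq[OF module_mult] module.span_empty[OF module_mult]
  by (simp add: algebra_simps)

lemma irrelevant_add: "p \<in> irrelevant \<Longrightarrow> q \<in> irrelevant \<Longrightarrow> p + q \<in> irrelevant"
  unfolding irrelevant_def ideal_gen_def by (rule module.span_add[OF module_mult])

lemma irrelevant_mult: "p \<in> irrelevant \<Longrightarrow> r * p \<in> irrelevant"
  unfolding irrelevant_def ideal_gen_def by (rule module.span_scale[OF module_mult])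

lemma irrelevant_0: "0 \<in> irrelevant"
  unfolding irrelevant_def ideal_gen_def by (rule module.span_zero[OF module_mult])

lemma irrelevant_uminus: "p \<in> irrelevant \<Longrightarrow> - p \<in> irrelevant"
  unfolding irrelevant_def ideal_gen_def by (rule module.span_neg[OF module_mult])

lemma irrelevant_diff: "p \<in> irrelevant \<Longrightarrow> q \<in> irrelevant \<Longrightarrow> p - q \<in> irrelevant"
  unfolding irrelevant_def ideal_gen_def by (rule module.span_diff[OF module_mult])

lemma irrelevant_Var: "Var a \<in> irrelevant"
  unfolding irrelevant_def ideal_gen_def
  by (rule module.span_base[OF module_mult]) (cases a; simp)

lemma irrelevant_sum: "(\<And>i. i \<in> A \<Longrightarrow> f i \<in> irrelevant) \<Longrightarrow> sum f A \<in> irrelevant"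
  by (induction A rule: infinite_finite_induct) (auto simp: irrelevant_0 irrelevant_add)

lemma irrelevant_quadric:
  assumes "f \<in> piece 2 0"
  shows "f \<in> irrelevant"
proof -
  obtain a b c where "f = C a * X^2 + C b * (X * Y) + C c * Y^2" by (rule piece_2_0_cases[OF assms])
  then show ?thesis unfolding power2_eq_square
    by (simp only:) (intro irrelevant_add irrelevant_mult irrelevant_Var)
qed

section \<open>Graded maps given by matrices\<close>

lemma mat_of_rows_list_mult_vec:
  assumes "x \<in> carrier_vec n" "\<forall>r\<in>set rs. length r = n"
  shows "mat_of_rows_list n rs *\<^sub>v x = vec_of_list (map (\<lambda>r. \<Sum>j<n. r ! j * x $ j) rs)"
  using assms
  by (intro eq_vecI) (auto simp: mat_of_rows_list_def scalar_prod_def vec_of_list_index lessThan_atLeast0)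

lemma mat_mult_smult_vec:
  fixes M :: "'a::comm_ring_1 mat"
  assumes "M \<in> carrier_mat nr nc" "x \<in> carrier_vec nc"
  shows "M *\<^sub>v (r \<cdot>\<^sub>v x) = r \<cdot>\<^sub>v (M *\<^sub>v x)"
  using assms by (intro eq_vecI) (auto simp: scalar_prod_def sum_distrib_left mult.left_commute)

lemma bigraded_hom_mat:
  assumes M: "M \<in> carrier_mat (length G) (length F)"
    and deg: "\<And>i j. i < length G \<Longrightarrow> j < length F \<Longrightarrow>
      M $$ (i, j) \<in> piece (fst (G ! i) - fst (F ! j)) (snd (G ! i) - snd (F ! j))"
  shows "bigraded_hom F G (\<lambda>x. M *\<^sub>v x)"
proof -
  have comp: "(M *\<^sub>v x) $ i = (\<Sum>j\<in>{0..<length F}. M $$ (i, j) * x $ j)"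
    if "x \<in> carrier_vec (length F)" "i < length G" for x i
    using that M by (simp add: scalar_prod_def)
  have "M *\<^sub>v x \<in> free_piece G m n" if x: "x \<in> free_piece F m n" for x m n
  proof -
    have xc: "x \<in> carrier_vec (length F)"
      and xp: "\<And>j. j < length F \<Longrightarrow> x $ j \<in> piece (m + fst (F ! j)) (n + snd (F ! j))"
      using x by (auto simp: free_piece_def free_mod_def)
    have "(M *\<^sub>v x) $ i \<in> piece (m + fst (G ! i)) (n + snd (G ! i))" if "i < length G" for i
      unfolding comp[OF xc that]
      by (rule piece_sum, rule piece_mult'[OF deg[OF that] xp]) auto
    then show ?thesis using M xc by (auto simp: free_piece_def free_mod_def)
  qed
  then show ?thesis
    using M unfolding bigraded_hom_def free_mod_def
    by (auto simp: mult_add_distrib_mat_vec[OF M] mat_mult_smult_vec[OF M])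
qed

text \<open>Reduces minimality of the resolution to an inspection of matrix entries.\<close>

lemma mat_mult_vec_irrelevant:
  assumes M: "M \<in> carrier_mat nr nc"
    and irr: "\<And>i j. i < nr \<Longrightarrow> j < nc \<Longrightarrow> M $$ (i, j) \<in> irrelevant"
    and "x \<in> carrier_vec nc" "i < nr"
  shows "(M *\<^sub>v x) $ i \<in> irrelevant"
proof -
  have "(M *\<^sub>v x) $ i = (\<Sum>j\<in>{0..<nc}. x $ j * M $$ (i, j))"
    using assms by (simp add: scalar_prod_def mult.commute)
  then show ?thesis using irr \<open>i < nr\<close> by (auto intro!: irrelevant_sum irrelevant_mult)
qed

text \<open>Vectors are to remain \<open>vec_of_list\<close> of explicit lists, so that equations
  between them become equations between lists.\<close>

declare vec_of_list_Cons [simp del] vec_of_list_Nil [simp del] vec_of_list_map [simp del]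

lemma vec_eq_vec_of_list: "x \<in> carrier_vec n \<Longrightarrow> x = vec_of_list (map (\<lambda>i. x $ i) [0..<n])"
  by (intro eq_vecI) (auto simp: vec_of_list_index)

lemma carrier_vec_3: "x \<in> carrier_vec 3 \<Longrightarrow> x = vec_of_list [x $ 0, x $ 1, x $ 2]"
  and carrier_vec_4: "x \<in> carrier_vec 4 \<Longrightarrow> x = vec_of_list [x $ 0, x $ 1, x $ 2, x $ 3]"
  and carrier_vec_5: "x \<in> carrier_vec 5 \<Longrightarrow> x = vec_of_list [x $ 0, x $ 1, x $ 2, x $ 3, x $ 4]"
  and carrier_vec_1: "x \<in> carrier_vec 1 \<Longrightarrow> x = vec_of_list [x $ 0]"
  by (rule trans[OF vec_eq_vec_of_list], assumption, simp add: upt_rec numeral_eq_Suc)+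

lemma vec_of_list_eq_iff: "vec_of_list xs = vec_of_list ys \<longleftrightarrow> xs = ys"
  by (metis list_vec)

lemma vec_of_list_in_carrier: "length xs = n \<Longrightarrow> vec_of_list xs \<in> carrier_vec n"
  by (rule carrier_vecI) simp

lemma zero_vec_eq_vec_of_list: "0\<^sub>v n = vec_of_list (replicate n 0)"
  by (intro eq_vecI) (auto simp: vec_of_list_index)

section \<open>The explicit differentials\<close>

context coprime_quadrics
begin

definition aug :: "'k bipoly vec \<Rightarrow> 'k bipoly" where
  "aug x = u * Z * x $ 0 + (u * W + v * Z) * x $ 1 + v * W * x $ 2"

definition rows1 :: "'k bipoly list list" where
  "rows1 = [[v * v, u * W + v * Z, v * W, 0, W * W],
            [- (u * v), - (u * Z), 0, v * W, - (Z * W)],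
            [u * u, 0, - (u * Z), - (u * W + v * Z), Z * Z]]"

text \<open>The columns record that u and v times (w^2, -z w, z^2), and z and w times (v^2, -u v,
  u^2), are combinations of Koszul syzygies.\<close>

definition rows2 :: "'k bipoly list list" where
  "rows2 = [[0, 0, Z, W], [- W, 0, - v, 0], [Z, - W, u, - v], [0, Z, 0, u], [u, v, 0, 0]]"

text \<open>The entries -v, u cancel in the coordinate of (w^2, -z w, z^2), the entries w, -z in
  that of (v^2, -u v, u^2).\<close>

definition rows3 :: "'k bipoly list list" where
  "rows3 = [[- v], [u], [W], [- Z]]"

definition M1 where "M1 = mat_of_rows_list 5 rows1"
definition M2 where "M2 = mat_of_rows_list 4 rows2"
definition M3 where "M3 = mat_of_rows_list 1 rows3"

lemma M1_mult: "x \<in> carrier_vec 5 \<Longrightarrow> M1 *\<^sub>v x = vec_of_list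
  [v * v * x $ 0 + (u * W + v * Z) * x $ 1 + v * W * x $ 2 + W * W * x $ 4,
   - (u * v) * x $ 0 - u * Z * x $ 1 + v * W * x $ 3 - Z * W * x $ 4,
   u * u * x $ 0 - u * Z * x $ 2 - (u * W + v * Z) * x $ 3 + Z * Z * x $ 4]"
  unfolding M1_def by (subst mat_of_rows_list_mult_vec)
    (simp_all add: rows1_def vec_of_list_eq_iff numeral_eq_Suc lessThan_Suc algebra_simps)

lemma M2_mult: "x \<in> carrier_vec 4 \<Longrightarrow> M2 *\<^sub>v x = vec_of_list
  [Z * x $ 2 + W * x $ 3,
   - W * x $ 0 - v * x $ 2,
   Z * x $ 0 - W * x $ 1 + u * x $ 2 - v * x $ 3,
   Z * x $ 1 + u * x $ 3,
   u * x $ 0 + v * x $ 1]"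
  unfolding M2_def by (subst mat_of_rows_list_mult_vec)
    (simp_all add: rows2_def vec_of_list_eq_iff numeral_eq_Suc lessThan_Suc algebra_simps)

lemma M3_mult: "x \<in> carrier_vec 1 \<Longrightarrow> M3 *\<^sub>v x = vec_of_list [- v * x $ 0, u * x $ 0, W * x $ 0, - Z * x $ 0]"
  unfolding M3_def by (subst mat_of_rows_list_mult_vec)
    (simp_all add: rows3_def vec_of_list_eq_iff numeral_eq_Suc lessThan_Suc algebra_simps)

lemma M_carrier: "M1 \<in> carrier_mat 3 5" "M2 \<in> carrier_mat 5 4" "M3 \<in> carrier_mat 4 1"
  by (rule carrier_matI; simp add: M1_def M2_def M3_def rows1_def rows2_def rows3_def mat_of_rows_list_def)+

lemma ker_aug: "{x \<in> carrier_vec 3. aug x = 0} = (\<lambda>x. M1 *\<^sub>v x) ` carrier_vec 5"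
proof (intro equalityI subsetI)
  fix x assume "x \<in> {x \<in> carrier_vec 3. aug x = 0}"
  then have x: "x \<in> carrier_vec 3" and eq: "aug x = 0" by auto
  obtain f1 g1 g2 g3 f2 where *: "x $ 0 = v * v * f1 + (u * W + v * Z) * g1 + v * W * g2 + W * W * f2"
    "x $ 1 = - (u * v) * f1 - u * Z * g1 + v * W * g3 - Z * W * f2"
    "x $ 2 = u * u * f1 - u * Z * g2 - (u * W + v * Z) * g3 + Z * Z * f2"
    by (rule exact_at_F0[OF eq[unfolded aug_def]])
  have c: "vec_of_list [f1, g1, g2, g3, f2] \<in> carrier_vec 5" by (rule vec_of_list_in_carrier) simp
  have "x = M1 *\<^sub>v vec_of_list [f1, g1, g2, g3, f2]"
    by (subst carrier_vec_3[OF x], subst M1_mult[OF c])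
       (simp add: vec_of_list_eq_iff vec_of_list_index * [unfolded One_nat_def])
  then show "x \<in> (\<lambda>x. M1 *\<^sub>v x) ` carrier_vec 5" using c by blast
next
  fix y assume "y \<in> (\<lambda>x. M1 *\<^sub>v x) ` carrier_vec 5"
  then obtain x where x: "x \<in> carrier_vec 5" and y: "y = M1 *\<^sub>v x" by blast
  have "aug y = 0"
    unfolding y M1_mult[OF x] aug_def by (simp add: vec_of_list_index numeral_2_eq_2 algebra_simps)
  then show "y \<in> {x \<in> carrier_vec 3. aug x = 0}"
    using mult_mat_vec_carrier[OF M_carrier(1) x] y by simp
qed

lemma ker_M1: "{x \<in> carrier_vec 5. M1 *\<^sub>v x = 0\<^sub>v 3} = (\<lambda>x. M2 *\<^sub>v x) ` carrier_vec 4"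
proof (intro equalityI subsetI)
  fix x assume "x \<in> {x \<in> carrier_vec 5. M1 *\<^sub>v x = 0\<^sub>v 3}"
  then have x: "x \<in> carrier_vec 5" and eq: "M1 *\<^sub>v x = 0\<^sub>v 3" by auto
  have "v * v * x $ 0 + (u * W + v * Z) * x $ 1 + v * W * x $ 2 + W * W * x $ 4 = 0"
   "- (u * v) * x $ 0 - u * Z * x $ 1 + v * W * x $ 3 - Z * W * x $ 4 = 0"
   "u * u * x $ 0 - u * Z * x $ 2 - (u * W + v * Z) * x $ 3 + Z * Z * x $ 4 = 0"
    using eq unfolding M1_mult[OF x] zero_vec_eq_vec_of_list vec_of_list_eq_iff
    by (simp_all add: numeral_3_eq_3)
  then obtain c0 c1 c2 c3 where *: "x $ 0 = Z * c2 + W * c3" "x $ 1 = - W * c0 - v * c2"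
    "x $ 2 = Z * c0 - W * c1 + u * c2 - v * c3" "x $ 3 = Z * c1 + u * c3" "x $ 4 = u * c0 + v * c1"
    by (rule exact_at_F1)
  have c: "vec_of_list [c0, c1, c2, c3] \<in> carrier_vec 4" by (rule vec_of_list_in_carrier) simp
  have "x = M2 *\<^sub>v vec_of_list [c0, c1, c2, c3]"
    by (subst carrier_vec_5[OF x], subst M2_mult[OF c])
       (simp add: vec_of_list_eq_iff vec_of_list_index * [unfolded One_nat_def])
  then show "x \<in> (\<lambda>x. M2 *\<^sub>v x) ` carrier_vec 4" using c by blast
next
  fix y assume "y \<in> (\<lambda>x. M2 *\<^sub>v x) ` carrier_vec 4"
  then obtain x where x: "x \<in> carrier_vec 4" and y: "y = M2 *\<^sub>v x" by blast
  have yc: "y \<in> carrier_vec 5" using mult_mat_vec_carrier[OF M_carrier(2) x] y by simp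
  have "M1 *\<^sub>v y = 0\<^sub>v 3"
    unfolding M1_mult[OF yc] unfolding y M2_mult[OF x] zero_vec_eq_vec_of_list vec_of_list_eq_iff
    by (simp add: vec_of_list_index eval_nat_numeral algebra_simps)
  then show "y \<in> {x \<in> carrier_vec 5. M1 *\<^sub>v x = 0\<^sub>v 3}" using yc by simp
qed

lemma ker_M2: "{x \<in> carrier_vec 4. M2 *\<^sub>v x = 0\<^sub>v 5} = (\<lambda>x. M3 *\<^sub>v x) ` carrier_vec 1"
proof (intro equalityI subsetI)
  fix x assume "x \<in> {x \<in> carrier_vec 4. M2 *\<^sub>v x = 0\<^sub>v 5}"
  then have x: "x \<in> carrier_vec 4" and eq: "M2 *\<^sub>v x = 0\<^sub>v 5" by auto
  have "Z * x $ 2 + W * x $ 3 = 0" "- W * x $ 0 - v * x $ 2 = 0" "Z * x $ 1 + u * x $ 3 = 0"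
    using eq unfolding M2_mult[OF x] zero_vec_eq_vec_of_list vec_of_list_eq_iff
    by (simp_all add: numeral_eq_Suc)
  then obtain b where *: "x $ 0 = - v * b" "x $ 1 = u * b" "x $ 2 = W * b" "x $ 3 = - Z * b"
    by (rule exact_at_F2)
  have c: "vec_of_list [b] \<in> carrier_vec 1" by (rule vec_of_list_in_carrier) simp
  have "x = M3 *\<^sub>v vec_of_list [b]"
    by (subst carrier_vec_4[OF x], subst M3_mult[OF c])
       (simp add: vec_of_list_eq_iff vec_of_list_index * [unfolded One_nat_def])
  then show "x \<in> (\<lambda>x. M3 *\<^sub>v x) ` carrier_vec 1" using c by blast
next
  fix y assume "y \<in> (\<lambda>x. M3 *\<^sub>v x) ` carrier_vec 1"
  then obtain x where x: "x \<in> carrier_vec 1" and y: "y = M3 *\<^sub>v x" by blast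
  have yc: "y \<in> carrier_vec 4" using mult_mat_vec_carrier[OF M_carrier(3) x] y by simp
  have "M2 *\<^sub>v y = 0\<^sub>v 5"
    unfolding M2_mult[OF yc] unfolding y M3_mult[OF x] zero_vec_eq_vec_of_list vec_of_list_eq_iff
    by (simp add: vec_of_list_index eval_nat_numeral algebra_simps)
  then show "y \<in> {x \<in> carrier_vec 4. M2 *\<^sub>v x = 0\<^sub>v 5}" using yc by simp
qed

lemma ker_M3: "{x \<in> carrier_vec 1. M3 *\<^sub>v x = 0\<^sub>v 4} = {0\<^sub>v 1}"
proof (intro equalityI subsetI)
  fix x assume "x \<in> {x \<in> carrier_vec 1. M3 *\<^sub>v x = 0\<^sub>v 4}"
  then have x: "x \<in> carrier_vec 1" and eq: "M3 *\<^sub>v x = 0\<^sub>v 4" by auto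
  have "u * x $ 0 = 0"
    using eq unfolding M3_mult[OF x] zero_vec_eq_vec_of_list vec_of_list_eq_iff
    by (simp add: numeral_eq_Suc)
  then show "x \<in> {0\<^sub>v 1}" using carrier_vec_1[OF x] u_nonzero by (simp add: zero_vec_eq_vec_of_list)
qed (use M_carrier in auto)

lemma irrelevant_uv: "u \<in> irrelevant" "v \<in> irrelevant"
  using irrelevant_quadric u_piece v_piece by blast+

lemma piece_entries:
  "v * v \<in> piece 4 0" "u * v \<in> piece 4 0" "u * u \<in> piece 4 0"
  "u * W \<in> piece 2 1" "u * Z \<in> piece 2 1" "v * W \<in> piece 2 1" "v * Z \<in> piece 2 1"
  "Z * W \<in> piece 0 2" "W * W \<in> piece 0 2" "Z * Z \<in> piece 0 2"
  using piece_mult[OF v_piece v_piece] piece_mult[OF u_piece v_piece] piece_mult[OF u_piece u_piece]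
    piece_mult[OF u_piece piece_Var(4)] piece_mult[OF u_piece piece_Var(3)]
    piece_mult[OF v_piece piece_Var(4)] piece_mult[OF v_piece piece_Var(3)]
    piece_mult[OF piece_Var(3) piece_Var(4)] piece_mult[OF piece_Var(4) piece_Var(4)]
    piece_mult[OF piece_Var(3) piece_Var(3)]
  by simp_all

lemma resolution:
  "\<exists>aug d. minimal_bigraded_free_resolution (ideal_gen {u * Z, u * W + v * Z, v * W})
    [replicate 3 (-2, -1),
     [(-6, -1)] @ replicate 3 (-4, -2) @ [(-2, -3)],
     replicate 2 (-4, -3) @ replicate 2 (-6, -2),
     [(-6, -3)]]
    aug d"
proof -
  define Fs :: "twists list" where "Fs = [replicate 3 (-2, -1),
     [(-6, -1)] @ replicate 3 (-4, -2) @ [(-2, -3)],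
     replicate 2 (-4, -3) @ replicate 2 (-6, -2),
     [(-6, -3)]]"
  \<comment> \<open>A resolution has a differential for every index; past the third they are empty
    matrices of shape 1 x 0 and then 0 x 0.\<close>
  define D :: "nat \<Rightarrow> 'k bipoly mat" where
    "D i = (if i = 0 then M1 else if i = 1 then M2 else if i = 2 then M3
       else 0\<^sub>m (length (res_term Fs i)) (length (res_term Fs (Suc i))))" for i
  have F: "res_term Fs 0 = [(-2,-1),(-2,-1),(-2,-1)]"
    "res_term Fs (Suc 0) = [(-6,-1),(-4,-2),(-4,-2),(-4,-2),(-2,-3)]"
    "res_term Fs (Suc (Suc 0)) = [(-4,-3),(-4,-3),(-6,-2),(-6,-2)]"
    "res_term Fs (Suc (Suc (Suc 0))) = [(-6,-3)]"
    "\<And>i. res_term Fs (Suc (Suc (Suc (Suc i)))) = []"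
    by (simp_all add: Fs_def res_term_def numeral_eq_Suc)
  have len: "length (res_term Fs 0) = 3" "length (res_term Fs (Suc 0)) = 5"
    "length (res_term Fs (Suc (Suc 0))) = 4" "length (res_term Fs (Suc (Suc (Suc 0)))) = 1"
    by (simp_all add: F)
  have i_cases: thesis if "i = 0 \<Longrightarrow> thesis" "i = Suc 0 \<Longrightarrow> thesis"
      "i = Suc (Suc 0) \<Longrightarrow> thesis" "\<And>j. i = Suc (Suc (Suc j)) \<Longrightarrow> thesis" for i :: nat and thesis
    using that by (metis not0_implies_Suc)
  have Dc: "D i \<in> carrier_mat (length (res_term Fs i)) (length (res_term Fs (Suc i)))" for i
    by (rule i_cases[of i]) (use M_carrier in \<open>simp_all add: D_def len\<close>)
  note pieces = piece_entries piece_Var u_piece v_piece piece_0 piece_add piece_diff piece_uminus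
  note irrs = irrelevant_Var irrelevant_uv irrelevant_0 irrelevant_add irrelevant_diff irrelevant_mult irrelevant_uminus
  \<comment> \<open>One pass over the entries settles both homogeneity and minimality.\<close>
  have deg: "D i $$ (a, b) \<in> piece (fst (res_term Fs i ! a) - fst (res_term Fs (Suc i) ! b))
      (snd (res_term Fs i ! a) - snd (res_term Fs (Suc i) ! b)) \<and> D i $$ (a, b) \<in> irrelevant"
    if "a < length (res_term Fs i)" "b < length (res_term Fs (Suc i))" for i a b
  proof (rule i_cases[of i])
    assume i: "i = 0"
    have "a \<in> {0,1,2}" "b \<in> {0,1,2,3,4}" using that by (auto simp: i F)
    then show ?thesis
      by (auto simp: i F D_def M1_def rows1_def mat_of_rows_list_def pieces irrs)
  next
    assume i: "i = Suc 0"
    have "a \<in> {0,1,2,3,4}" "b \<in> {0,1,2,3}" using that by (auto simp: i F)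
    then show ?thesis
      by (auto simp: i F D_def M2_def rows2_def mat_of_rows_list_def pieces irrs)
  next
    assume i: "i = Suc (Suc 0)"
    have "a \<in> {0,1,2,3}" "b = 0" using that by (auto simp: i F)
    then show ?thesis
      by (auto simp: i F D_def M3_def rows3_def mat_of_rows_list_def pieces irrs)
  qed (use that in \<open>simp add: F\<close>)
  have hom: "bigraded_hom (res_term Fs (Suc i)) (res_term Fs i) (\<lambda>x. D i *\<^sub>v x)" for i
    by (rule bigraded_hom_mat[OF Dc]) (use deg in blast)
  have aug_hom: "bigraded_hom_to_ring (res_term Fs 0) aug"
    unfolding bigraded_hom_to_ring_def
  proof (intro conjI allI ballI)
    fix m n and x :: "'k bipoly vec" assume "x \<in> free_piece (res_term Fs 0) m n"
    then have "\<forall>j<3. x $ j \<in> piece (m - 2) (n - 1)"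
      by (auto simp: free_piece_def F nth_Cons' less_Suc_eq numeral_3_eq_3)
    then have "x $ 0 \<in> piece (m - 2) (n - 1)" "x $ 1 \<in> piece (m - 2) (n - 1)" "x $ 2 \<in> piece (m - 2) (n - 1)"
      by simp_all
    then show "aug x \<in> piece m n"
      unfolding aug_def by (intro piece_add piece_mult'[of _ 2 1 _ "m - 2" "n - 1"] piece_entries) simp_all
  qed (auto simp: free_mod_def len aug_def algebra_simps)
  have img: "aug ` free_mod (res_term Fs 0) = ideal_gen {u * Z, u * W + v * Z, v * W}"
  proof (intro equalityI subsetI)
    fix p assume "p \<in> ideal_gen {u * Z, u * W + v * Z, v * W}"
    then obtain a b c where "p = a * (u * Z) + b * (u * W + v * Z) + c * (v * W)"
      unfolding ideal_gen_triple by blast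
    then have "p = aug (vec_of_list [a, b, c])"
      by (simp add: aug_def vec_of_list_index numeral_2_eq_2 algebra_simps)
    moreover have "vec_of_list [a, b, c] \<in> free_mod (res_term Fs 0)"
      unfolding free_mod_def len by (rule vec_of_list_in_carrier) simp
    ultimately show "p \<in> aug ` free_mod (res_term Fs 0)" by blast
  next
    fix p assume "p \<in> aug ` free_mod (res_term Fs 0)"
    then obtain x where "p = aug x" by blast
    then have "p = x $ 0 * (u * Z) + x $ 1 * (u * W + v * Z) + x $ 2 * (v * W)"
      by (simp add: aug_def algebra_simps)
    then show "p \<in> ideal_gen {u * Z, u * W + v * Z, v * W}" unfolding ideal_gen_triple by blast
  qed
  \<comment> \<open>A map out of the zero module has image 0. This is the right-hand side of
    exactness at the last nonzero term and beyond it.\<close>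
  have zero_dim: "(\<lambda>x. D i *\<^sub>v x) ` carrier_vec 0 = {0\<^sub>v (length (res_term Fs i))}"
    if "length (res_term Fs (Suc i)) = 0" for i
  proof -
    have "D i *\<^sub>v x = 0\<^sub>v (length (res_term Fs i))" if "x \<in> carrier_vec 0" for x
      using Dc[of i] \<open>length (res_term Fs (Suc i)) = 0\<close> that by (intro eq_vecI) (auto simp: scalar_prod_def)
    then have "(\<lambda>x. D i *\<^sub>v x) ` carrier_vec 0 = (\<lambda>x::'k bipoly vec. 0\<^sub>v (length (res_term Fs i))) ` carrier_vec 0"
      by (rule image_cong[OF refl])
    also have "\<dots> = {0\<^sub>v (length (res_term Fs i))}"
      by (rule image_constant[of "0\<^sub>v 0"]) simp
    finally show ?thesis .
  qed
  have exact: "{x \<in> free_mod (res_term Fs (Suc i)). D i *\<^sub>v x = 0\<^sub>v (length (res_term Fs i))} =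
          (\<lambda>x. D (Suc i) *\<^sub>v x) ` free_mod (res_term Fs (Suc (Suc i)))" for i
  proof (rule i_cases[of i])
    assume "i = 0" then show ?thesis using ker_M1 by (simp add: free_mod_def len D_def)
  next
    assume "i = Suc 0" then show ?thesis using ker_M2 by (simp add: free_mod_def len D_def)
  next
    assume i: "i = Suc (Suc 0)"
    show ?thesis using ker_M3 zero_dim[of "Suc i"] by (simp add: i free_mod_def len F(5)) (simp add: D_def)
  next
    fix j assume i: "i = Suc (Suc (Suc j))"
    have "D i *\<^sub>v x = 0\<^sub>v (length (res_term Fs i))" if "x \<in> carrier_vec 0" for x
      using zero_dim[of i] that by (auto simp: i F)
    moreover have "x = 0\<^sub>v 0" if "x \<in> carrier_vec 0" for x :: "'k bipoly vec" using that by auto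
    ultimately show ?thesis using zero_dim[of "Suc i"] by (auto simp: i F free_mod_def)
  qed
  have "minimal_bigraded_free_resolution (ideal_gen {u * Z, u * W + v * Z, v * W}) Fs aug (\<lambda>i x. D i *\<^sub>v x)"
    unfolding minimal_bigraded_free_resolution_def bigraded_free_resolution_def
  proof (intro conjI allI ballI impI)
    show "{x \<in> free_mod (res_term Fs 0). aug x = 0} = (\<lambda>x. D 0 *\<^sub>v x) ` free_mod (res_term Fs 1)"
      using ker_aug by (simp add: free_mod_def len D_def)
    fix i j and x :: "'k bipoly vec" assume "x \<in> free_mod (res_term Fs (Suc i))" "j < length (res_term Fs i)"
    then show "(D i *\<^sub>v x) $ j \<in> irrelevant"
      unfolding free_mod_def by (intro mat_mult_vec_irrelevant[OF Dc]) (use deg in blast)+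
  qed (fact hom aug_hom img exact)+
  then show ?thesis unfolding Fs_def by blast
qed

end

section \<open>Normal form of a non-generic net\<close>

lemma C_mult: "C (a * b) = C a * C b"
  by (simp add: mult_single)

interpretation bipoly_space: vector_space "cmul :: 'k::field \<Rightarrow> 'k bipoly \<Rightarrow> 'k bipoly"
  by standard (simp_all add: cmul_def algebra_simps single_add C_mult)

lemma kspan_eq: "kspan S = bipoly_space.span S"
  by (simp add: kspan_def)

lemma kspan_base: "x \<in> S \<Longrightarrow> x \<in> kspan S"
  unfolding kspan_eq by (rule bipoly_space.span_base)

lemma kspan_superset: "S \<subseteq> kspan S"
  unfolding kspan_eq by (rule bipoly_space.span_superset)

lemma kspan_add: "x \<in> kspan S \<Longrightarrow> y \<in> kspan S \<Longrightarrow> x + y \<in> kspan S"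
  unfolding kspan_eq by (rule bipoly_space.span_add)

lemma kspan_C_mult: "x \<in> kspan S \<Longrightarrow> C c * x \<in> kspan S"
  using bipoly_space.span_scale[of x S c] by (simp add: kspan_eq cmul_def)

lemma kspan_triple: "x \<in> kspan {p, q, r} \<longleftrightarrow> (\<exists>a b c. x = C a * p + C b * q + C c * r)"
  unfolding kspan_eq bipoly_space.span_breakdown_eq bipoly_space.span_empty
  by (simp add: cmul_def algebra_simps)

lemma kspan_singleton: "x \<in> kspan {p} \<longleftrightarrow> (\<exists>a. x = C a * p)"
  unfolding kspan_eq bipoly_space.span_breakdown_eq bipoly_space.span_empty
  by (simp add: cmul_def)

lemma kspan_subset: "S \<subseteq> kspan T \<Longrightarrow> kspan S \<subseteq> kspan T"
  unfolding kspan_eq by (rule bipoly_space.span_minimal[OF _ bipoly_space.subspace_span])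

lemma C_inverse_mult: "c \<noteq> 0 \<Longrightarrow> C (inverse c :: 'k::field) * (C c * p) = p"
  by (simp add: mult_single flip: mult.assoc)

lemma C_mult_C: "C a * (C b * p) = C (a * b) * p"
  by (simp add: mult_single flip: mult.assoc)

lemma C_eq_0 [simp]: "C c = 0 \<longleftrightarrow> c = 0"
  by (metis lookup_single_eq lookup_zero single_zero)

lemma C_eq_0_iff: "C (c::'k::field) * p = 0 \<longleftrightarrow> c = 0 \<or> p = 0"
  by simp

lemma kspan_singleton_scale: "c \<noteq> 0 \<Longrightarrow> kspan {C c * p} = kspan {p}"
  using kspan_C_mult[of "C c * p" "{C c * p}" "inverse c"]
  by (intro equalityI kspan_subset) (simp_all add: C_inverse_mult kspan_base kspan_C_mult)

section \<open>Linear independence and spans over k\<close>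

text \<open>Stated with coefficients, since independence of the set {x, y} does not exclude x =
  y.\<close>

definition indep2 :: "('k::field) bipoly \<Rightarrow> 'k bipoly \<Rightarrow> bool" where
  "indep2 x y \<longleftrightarrow> (\<forall>a b. C a * x + C b * y = 0 \<longrightarrow> a = 0 \<and> b = 0)"

definition indep3 :: "('k::field) bipoly \<Rightarrow> 'k bipoly \<Rightarrow> 'k bipoly \<Rightarrow> bool" where
  "indep3 x y z \<longleftrightarrow> (\<forall>a b c. C a * x + C b * y + C c * z = 0 \<longrightarrow> a = 0 \<and> b = 0 \<and> c = 0)"

lemma indep2D: "indep2 x y \<Longrightarrow> C a * x + C b * y = 0 \<Longrightarrow> a = 0 \<and> b = 0"
  by (simp add: indep2_def)

lemma indep2_nonzero: "indep2 x y \<Longrightarrow> x \<noteq> 0 \<and> y \<noteq> 0"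
  using indep2D[of x y 1 0] indep2D[of x y 0 1] by auto

lemma not_indep2:
  assumes "\<not> indep2 x y" "x \<noteq> 0" "y \<noteq> 0"
  obtains c where "c \<noteq> 0" "y = C c * x"
proof -
  obtain a b where ab: "C a * x + C b * y = 0" "a \<noteq> 0 \<or> b \<noteq> 0"
    using assms(1) by (auto simp: indep2_def)
  have b: "b \<noteq> 0" and a: "a \<noteq> 0"
    using ab assms(2,3) C_eq_0_iff[of a x] C_eq_0_iff[of b y] by auto
  have "C b * y = C (- a) * x" using ab(1) by (simp add: single_uminus add_eq_0_iff)
  then have "y = C (inverse b) * (C (- a) * x)" using C_inverse_mult[OF b, of y] by simp
  then have "y = C (inverse b * (- a)) * x" by (simp only: C_mult_C)
  then show ?thesis using that[of "inverse b * (- a)"] a b by simp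
qed

lemma indep2_independent:
  assumes "indep2 x y"
  shows "x \<noteq> y \<and> bipoly_space.independent {x, y}"
proof -
  have "x \<noteq> y" using indep2D[OF assms, of 1 "-1"] by (auto simp: single_uminus)
  moreover have "x \<notin> bipoly_space.span {y}"
  proof
    assume "x \<in> bipoly_space.span {y}"
    then obtain a where "x = C a * y" using kspan_singleton by (auto simp: kspan_eq)
    then show False using indep2D[OF assms, of 1 "- a"] by (simp add: single_uminus)
  qed
  ultimately show ?thesis using indep2_nonzero[OF assms]
    by (simp add: bipoly_space.independent_insert)
qed

lemma indep3_independent:
  assumes "indep3 x y z"
  shows "card {x, y, z} = 3 \<and> bipoly_space.independent {x, y, z}"
proof -
  have "indep2 y z" using assms unfolding indep3_def indep2_def by (metis add_0 mult_zero_left single_zero)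
  note yz = indep2_independent[OF this] indep2_nonzero[OF this]
  have x: "x \<notin> bipoly_space.span {y, z}"
  proof
    assume "x \<in> bipoly_space.span {y, z}"
    then have "x \<in> kspan {y, y, z}" by (simp add: kspan_eq)
    then obtain a b c where "x = C a * y + C b * y + C c * z" unfolding kspan_triple by blast
    then have "C 1 * x + C (- a - b) * y + C (- c) * z = 0"
      by (simp add: single_uminus single_diff algebra_simps)
    then have "(1::'a) = 0" using assms unfolding indep3_def by blast
    then show False by simp
  qed
  then have "x \<notin> {y, z}" using bipoly_space.span_superset by blast
  then show ?thesis using x yz by (simp add: bipoly_space.independent_insert)
qed

lemma card_triple_le: "card {p, q, r} \<le> 3"
  by (simp add: card_insert_if)

text \<open>A generator outside the span of a, b, c would give four independent elements in the span
  of three.\<close>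

lemma kspan_triple_eq:
  assumes "indep3 a b c" "{a, b, c} \<subseteq> kspan {p, q, r}"
  shows "kspan {p, q, r} = kspan {a, b, c}"
proof (rule equalityI; rule kspan_subset)
  show "{a, b, c} \<subseteq> kspan {p, q, r}" by (rule assms(2))
  show "{p, q, r} \<subseteq> kspan {a, b, c}"
  proof (rule subsetI, rule ccontr)
    fix x assume x: "x \<in> {p, q, r}" "x \<notin> kspan {a, b, c}"
    then have n: "x \<notin> {a, b, c}" using kspan_superset[of "{a, b, c}"] by blast
    have "bipoly_space.independent (insert x {a, b, c})"
      using x(2) indep3_independent[OF assms(1)] unfolding kspan_eq by (metis bipoly_space.independent_insertI)
    moreover have "insert x {a, b, c} \<subseteq> bipoly_space.span {p, q, r}"
      using assms(2) kspan_base[OF x(1)] by (simp flip: kspan_eq)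
    ultimately have "card (insert x {a, b, c}) \<le> card {p, q, r}"
      using bipoly_space.independent_span_bound[of "{p, q, r}" "insert x {a, b, c}"] by simp
    moreover have "card (insert x {a, b, c}) = 4" using n indep3_independent[OF assms(1)] by simp
    ultimately show False using card_triple_le[of p q r] by linarith
  qed
qed

text \<open>Either p itself completes a, b to a spanning triple, or some generator lies outside the
  span of a, b, p. That generator is independent of a, b, and the triple spans by dimension.\<close>

lemma kspan_pair_extend:
  assumes "indep2 a b" "{a, b} \<subseteq> kspan {p, q, r}"
  obtains c where "c \<in> {p, q, r}" "{p, q, r} \<subseteq> kspan {a, b, c}"
proof (cases "{p, q, r} \<subseteq> kspan {a, b, p}")
  case True
  then show ?thesis by (intro that[of p]) auto
next
  case False
  then obtain c where c: "c \<in> {p, q, r}" "c \<notin> kspan {a, b, p}" by blast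
  then have n: "c \<notin> kspan {a, b}"
    unfolding kspan_eq by (meson bipoly_space.span_mono insert_mono subset_insertI subsetD empty_subsetI)
  have "indep3 a b c" unfolding indep3_def
  proof (intro allI impI)
    fix k l m assume e: "C k * a + C l * b + C m * c = 0"
    have "m = 0"
    proof (rule ccontr)
      assume m: "m \<noteq> 0"
      have "C m * c = C (- k) * a + C (- l) * b" using e
        by (simp add: single_uminus add_eq_0_iff algebra_simps)
      moreover have "C (- k) * a + C (- l) * b \<in> kspan {a, b}"
        by (intro kspan_add kspan_C_mult kspan_base) auto
      ultimately have "C (inverse m) * (C m * c) \<in> kspan {a, b}" by (simp only: kspan_C_mult)
      with n show False by (simp only: C_inverse_mult[OF m])
    qed
    with e indep2D[OF assms(1), of k l] show "k = 0 \<and> l = 0 \<and> m = 0" by simp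
  qed
  then have "kspan {p, q, r} = kspan {a, b, c}"
    using assms(2) c(1) kspan_base[of c] by (intro kspan_triple_eq) auto
  then have "{p, q, r} \<subseteq> kspan {a, b, c}" using kspan_superset by metis
  with c(1) show ?thesis by (rule that)
qed

lemma eval_at_kspan:
  assumes "x \<in> kspan S" "\<And>y. y \<in> S \<Longrightarrow> eval_at y s t = 0"
  shows "eval_at x s t = 0"
proof -
  have "bipoly_space.subspace {x. eval_at x s t = 0}"
    by (rule bipoly_space.subspaceI) (auto simp: eval_at_simps cmul_def)
  then have "bipoly_space.span S \<subseteq> {x. eval_at x s t = 0}"
    by (rule bipoly_space.span_minimal[rotated]) (use assms(2) in auto)
  then show ?thesis using assms(1) by (auto simp: kspan_eq)
qed

lemma ideal_gen_kspan:
  assumes "kspan S \<subseteq> kspan T"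
  shows "ideal_gen S \<subseteq> ideal_gen (T :: ('k::field) bipoly set)"
proof -
  interpret m: Modules.module "(*) :: 'k bipoly \<Rightarrow> 'k bipoly \<Rightarrow> 'k bipoly"
    by (rule module_mult)
  have "bipoly_space.subspace (m.span T)"
    by (rule bipoly_space.subspaceI) (auto simp: cmul_def intro: m.span_zero m.span_add m.span_scale)
  then have "bipoly_space.span T \<subseteq> m.span T"
    by (rule bipoly_space.span_minimal[rotated]) (rule m.span_superset)
  moreover have "S \<subseteq> bipoly_space.span T" using assms kspan_base[of _ S] by (auto simp: kspan_eq)
  ultimately have "S \<subseteq> m.span T" by blast
  then show ?thesis unfolding ideal_gen_def by (rule m.span_minimal[OF _ m.subspace_span])
qed

section \<open>Pairs of independent linear forms in z, w\<close>

lemma det_nonzero: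
  assumes "indep2 (C a1 * Z + C b1 * W) (C a2 * Z + C b2 * W)"
  shows "a1 * b2 - a2 * b1 \<noteq> 0"
proof
  assume d: "a1 * b2 - a2 * b1 = 0"
  have "C b2 * (C a1 * Z + C b1 * W) + C (- b1) * (C a2 * Z + C b2 * W) = C (a1 * b2 - a2 * b1) * Z"
    "C a2 * (C a1 * Z + C b1 * W) + C (- a1) * (C a2 * Z + C b2 * W) = C (- (a1 * b2 - a2 * b1)) * W"
    by (simp_all add: single_diff single_uminus C_mult algebra_simps)
  with d have "b1 = 0" "a1 = 0" using indep2D[OF assms] by (metis mult_zero_left neg_equal_0_iff_equal single_zero)+
  then show False using indep2_nonzero[OF assms] by simp
qed

lemma linear_combination:
  assumes "indep2 g1 g2" "g1 \<in> piece 0 1" "g2 \<in> piece 0 1" "g \<in> piece 0 1"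
  obtains a b where "g = C a * g1 + C b * g2"
proof -
  obtain a1 b1 where g1: "g1 = C a1 * Z + C b1 * W" by (rule piece_0_1_cases[OF assms(2)])
  obtain a2 b2 where g2: "g2 = C a2 * Z + C b2 * W" by (rule piece_0_1_cases[OF assms(3)])
  obtain a3 b3 where g: "g = C a3 * Z + C b3 * W" by (rule piece_0_1_cases[OF assms(4)])
  define d where "d = a1 * b2 - a2 * b1"
  have d: "d \<noteq> 0" using det_nonzero assms(1) unfolding g1 g2 d_def .
  have "C d * g = C (a3 * b2 - a2 * b3) * g1 + C (a1 * b3 - a3 * b1) * g2"
    unfolding d_def g g1 g2
    by (simp add: single_diff C_mult algebra_simps)
  then have "g = C (inverse d) * (C (a3 * b2 - a2 * b3) * g1 + C (a1 * b3 - a3 * b1) * g2)"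
    using C_inverse_mult[OF d, of g] by simp
  then show ?thesis by (intro that) (simp only: distrib_left C_mult_C)
qed

text \<open>Independent linear forms can replace z, w as coordinates: the coefficients of z and w in
  the relation lie in k[x, y], hence vanish, and the determinant inverts the change of
  coordinates.\<close>

lemma quadric_linear_indep:
  fixes f f' :: "('k::field) bipoly"
  assumes "indep2 g1 g2" "g1 \<in> piece 0 1" "g2 \<in> piece 0 1" "f \<in> piece 2 0" "f' \<in> piece 2 0"
    and "f * g1 + f' * g2 = 0"
  shows "f = 0 \<and> f' = 0"
proof -
  obtain a1 b1 where g1: "g1 = C a1 * Z + C b1 * W" by (rule piece_0_1_cases[OF assms(2)])
  obtain a2 b2 where g2: "g2 = C a2 * Z + C b2 * W" by (rule piece_0_1_cases[OF assms(3)])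
  have d: "a1 * b2 - a2 * b1 \<noteq> 0" using det_nonzero assms(1) unfolding g1 g2 .
  let ?p = "C a1 * f + C a2 * f'" and ?q = "C b1 * f + C b2 * f'"
  note k = kill_piece_2_0[OF assms(4)] kill_piece_2_0[OF assms(5)]
  have "Z * ?p + W * ?q = 0"
    using assms(6) unfolding g1 g2 by (simp add: algebra_simps)
  then obtain h where h: "?p = W * h" "?q = - Z * h" by (rule regular_zw)
  have "kill {Vw} ?p = 0" "kill {Vz} ?q = 0" unfolding h by simp_all
  then have p0: "?p = 0" and q0: "?q = 0" by (simp_all add: k)
  have "C (a1 * b2 - a2 * b1) * f = C b2 * ?p - C a2 * ?q"
    "C (a1 * b2 - a2 * b1) * f' = C a1 * ?q - C b1 * ?p"
    by (simp_all add: single_diff C_mult algebra_simps)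
  then have "C (a1 * b2 - a2 * b1) * f = 0" "C (a1 * b2 - a2 * b1) * f' = 0"
    unfolding p0 q0 by simp_all
  then show ?thesis using d by (simp only: C_eq_0_iff) simp
qed

lemma indep2_mult_left: "indep2 g g' \<Longrightarrow> f \<noteq> 0 \<Longrightarrow> indep2 (f * g) (f * g')"
proof -
  assume *: "indep2 g g'" "f \<noteq> 0"
  have "C a * (f * g) + C b * (f * g') = f * (C a * g + C b * g')" for a b
    by (simp add: algebra_simps)
  then show ?thesis using * unfolding indep2_def by simp
qed

lemma eval_at_piece_2_0: "f \<in> piece 2 0 \<Longrightarrow> eval_at f s t = eval_at f s t'"
  by (erule piece_2_0_cases) (simp add: eval_at_simps)

section \<open>Nets without base points\<close>

locale base_point_free_net =
  fixes p0 p1 p2 :: "('k::alg_closed_field) bipoly"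
  assumes pieces: "p0 \<in> piece 2 1" "p1 \<in> piece 2 1" "p2 \<in> piece 2 1"
    and nocz: "no_common_zeros {p0, p1, p2}"
begin

abbreviation "net \<equiv> kspan {p0, p1, p2}"

lemma no_base_point:
  assumes "{p0, p1, p2} \<subseteq> kspan S" "s \<noteq> (0, 0)" "t \<noteq> (0, 0)"
  obtains y where "y \<in> S" "eval_at y s t \<noteq> 0"
  using nocz assms eval_at_kspan[of _ S s t] unfolding no_common_zeros_def by blast

text \<open>At a root of f on the first factor, f g and f g' vanish for every t, while a third
  generator is linear in t and so has a zero.\<close>

lemma no_fixed_quadric:
  assumes "f \<in> piece 2 0" "f \<noteq> 0" "indep2 g g'" "f * g \<in> net" "f * g' \<in> net"
  shows False
proof -
  obtain p where p: "p \<in> {p0, p1, p2}" and sub: "{p0, p1, p2} \<subseteq> kspan {f * g, f * g', p}"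
    using kspan_pair_extend[OF indep2_mult_left[OF assms(3,2)]] assms(4,5) by blast
  then have "p \<in> piece 2 1" using pieces by auto
  then obtain a b where ab: "a \<in> piece 2 0" "b \<in> piece 2 0" "p = a * Z + b * W" by (rule piece_2_1_cases)
  obtain c0 c1 c2 where f: "f = C c0 * X^2 + C c1 * (X * Y) + C c2 * Y^2"
    by (rule piece_2_0_cases[OF assms(1)])
  obtain x y where xy: "(x, y) \<noteq> (0, 0)" "c0 * x^2 + c1 * (x * y) + c2 * y^2 = 0"
    by (rule binary_quadric_root)
  have f0: "eval_at f (x, y) t = 0" for t using xy(2) by (simp add: f eval_at_simps)
  \<comment> \<open>a and b involve x, y only, so the second argument (0, 0) is just a
    placeholder.\<close>
  define ea eb where "ea = eval_at a (x, y) (0, 0)" and "eb = eval_at b (x, y) (0, 0)"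
  \<comment> \<open>The zero of ea z + eb w; if this form is identically zero, any point will
    do.\<close>
  define t where "t = (if (eb, - ea) = (0, 0) then (1, 0) else (eb, - ea))"
  have t: "t \<noteq> (0, 0)" by (simp add: t_def split: if_splits)
  have "eval_at p (x, y) t = ea * fst t + eb * snd t"
    using eval_at_piece_2_0[OF ab(1), of "(x, y)" t "(0, 0)"] eval_at_piece_2_0[OF ab(2), of "(x, y)" t "(0, 0)"]
    by (simp add: ab(3) eval_at_simps ea_def eb_def)
  then have "eval_at p (x, y) t = 0" by (auto simp: t_def split: if_splits)
  moreover obtain h where "h \<in> {f * g, f * g', p}" "eval_at h (x, y) t \<noteq> 0"
    by (rule no_base_point[OF sub xy(1) t])
  ultimately show False using f0[of t] by (auto simp: eval_at_simps)
qed

text \<open>At the zero of g on the second factor, a third generator restricts to a binary quadric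
  in x, y, which has a root.\<close>

lemma no_fixed_line:
  assumes "g \<in> piece 0 1" "g \<noteq> 0" "indep2 f f'" "f * g \<in> net" "f' * g \<in> net"
  shows False
proof -
  have "indep2 (f * g) (f' * g)"
    using indep2_mult_left[OF assms(3,2)] by (simp add: mult.commute)
  then obtain p where p: "p \<in> {p0, p1, p2}" and sub: "{p0, p1, p2} \<subseteq> kspan {f * g, f' * g, p}"
    using kspan_pair_extend assms(4,5) by blast
  then have "p \<in> piece 2 1" using pieces by auto
  then obtain a b where ab: "a \<in> piece 2 0" "b \<in> piece 2 0" "p = a * Z + b * W" by (rule piece_2_1_cases)
  obtain a0 a1 a2 where a: "a = C a0 * X^2 + C a1 * (X * Y) + C a2 * Y^2"
    by (rule piece_2_0_cases[OF ab(1)])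
  obtain b0 b1 b2 where b: "b = C b0 * X^2 + C b1 * (X * Y) + C b2 * Y^2"
    by (rule piece_2_0_cases[OF ab(2)])
  obtain c d where g: "g = C c * Z + C d * W" by (rule piece_0_1_cases[OF assms(1)])
  have t: "(d, - c) \<noteq> (0, 0)" using assms(2) by (auto simp: g)
  obtain x y where xy: "(x, y) \<noteq> (0, 0)"
    "(a0 * d - b0 * c) * x^2 + (a1 * d - b1 * c) * (x * y) + (a2 * d - b2 * c) * y^2 = 0"
    by (rule binary_quadric_root)
  have "eval_at p (x, y) (d, - c) = 0"
    using xy(2) by (simp add: ab(3) a b eval_at_simps algebra_simps)
  moreover have "eval_at g (x, y) (d, - c) = 0" by (simp add: g eval_at_simps)
  moreover obtain h where "h \<in> {f * g, f' * g, p}" "eval_at h (x, y) (d, - c) \<noteq> 0"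
    by (rule no_base_point[OF sub xy(1) t])
  ultimately show False by (auto simp: eval_at_simps)
qed

text \<open>If g' were a multiple of g, independent f, f' would give a common factor g, and
  proportional ones would give the same point.\<close>

lemma distinct_points_indep:
  assumes "f \<in> piece 2 0" "f' \<in> piece 2 0" "g \<in> piece 0 1" "g' \<in> piece 0 1"
    and "f \<noteq> 0" "f' \<noteq> 0" "g \<noteq> 0" "g' \<noteq> 0" "f * g \<in> net" "f' * g' \<in> net"
    and ne: "kspan {f * g} \<noteq> kspan {f' * g'}"
  shows "indep2 g g'"
proof (rule ccontr)
  assume "\<not> indep2 g g'"
  then obtain c where c: "c \<noteq> 0" "g' = C c * g" by (rule not_indep2[OF _ assms(7,8)])
  have m: "f' * g' = (C c * f') * g" by (simp add: c algebra_simps)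
  have "\<not> indep2 f (C c * f')"
    using no_fixed_line[OF assms(3,7)] assms(9,10) unfolding m by blast
  moreover have "C c * f' \<noteq> 0" using c assms(6) by (simp add: C_eq_0_iff)
  ultimately obtain d where d: "d \<noteq> 0" "C c * f' = C d * f" using not_indep2[OF _ assms(5)] by blast
  have "f' * g' = C d * (f * g)" unfolding m d by (rule mult.assoc)
  then show False using ne kspan_singleton_scale[OF d(1), of "f * g"] by simp
qed

text \<open>With U = \<mu> f1 and V = \<nu> f2, the third point becomes (U + V) (g1 + g2), so the
  plane is spanned by the coefficients of (U + V T) (g1 + g2 T).\<close>

lemma net_spanned_by_conic:
  assumes f: "f1 \<in> piece 2 0" "f2 \<in> piece 2 0" "f3 \<in> piece 2 0" "f4 \<in> piece 2 0"
    and f0: "f1 \<noteq> 0" "f2 \<noteq> 0" "f3 \<noteq> 0" "f4 \<noteq> 0"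
    and g: "g1 \<in> piece 0 1" "g2 \<in> piece 0 1" and ind: "indep2 g1 g2"
    and mem: "f1 * g1 \<in> net" "f2 * g2 \<in> net" "f3 * (g1 + g2) \<in> net" "f4 * (C c * g1 + C d * g2) \<in> net"
    and cd: "c \<noteq> 0" "d \<noteq> 0" "c \<noteq> d"
  obtains \<mu> \<nu> where "\<mu> \<noteq> 0" "\<nu> \<noteq> 0" "f3 = C \<mu> * f1 + C \<nu> * f2"
    "indep3 (f1 * g1) (f2 * g2) (f3 * (g1 + g2))" "net = kspan {f1 * g1, f2 * g2, f3 * (g1 + g2)}"
proof -
  note zero = quadric_linear_indep[OF ind g]
  \<comment> \<open>Proportional f1 and f2 would be a common factor of two members of the
    net.\<close>
  have indf: "indep2 f1 f2"
  proof (rule ccontr)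
    assume "\<not> indep2 f1 f2"
    then obtain k where k: "k \<noteq> 0" "f2 = C k * f1" by (rule not_indep2[OF _ f0(1,2)])
    have "C (inverse k) * (f2 * g2) \<in> net" by (rule kspan_C_mult[OF mem(2)])
    moreover have "C (inverse k) * (f2 * g2) = f1 * g2"
      unfolding k(2) mult.assoc by (rule C_inverse_mult[OF k(1)])
    ultimately show False using no_fixed_quadric[OF f(1) f0(1) ind mem(1)] by simp
  qed
  have ind3: "indep3 (f1 * g1) (f2 * g2) (f3 * (g1 + g2))"
    unfolding indep3_def
  proof (intro allI impI)
    fix k l m assume "C k * (f1 * g1) + C l * (f2 * g2) + C m * (f3 * (g1 + g2)) = 0"
    then have "(C k * f1 + C m * f3) * g1 + (C l * f2 + C m * f3) * g2 = 0"
      by (simp add: algebra_simps)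
    then have z: "C k * f1 + C m * f3 = 0" "C l * f2 + C m * f3 = 0"
      using zero[of "C k * f1 + C m * f3" "C l * f2 + C m * f3"] f
      by (blast intro: piece_add piece_C_mult)+
    have "C k * f1 + C (- l) * f2 = (C k * f1 + C m * f3) - (C l * f2 + C m * f3)"
      by (simp add: single_uminus)
    then have "k = 0 \<and> - l = 0" unfolding z by (intro indep2D[OF indf]) simp
    with z(1) f0(3) show "k = 0 \<and> l = 0 \<and> m = 0" by (simp add: C_eq_0_iff)
  qed
  have net: "net = kspan {f1 * g1, f2 * g2, f3 * (g1 + g2)}"
    by (rule kspan_triple_eq[OF ind3]) (use mem in simp)
  obtain k l m where "f4 * (C c * g1 + C d * g2) = C k * (f1 * g1) + C l * (f2 * g2) + C m * (f3 * (g1 + g2))"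
    using mem(4) unfolding net kspan_triple by blast
  then have "(C c * f4 - C k * f1 - C m * f3) * g1 + (C d * f4 - C l * f2 - C m * f3) * g2 = 0"
    by (simp add: algebra_simps)
  then have "C c * f4 - C k * f1 - C m * f3 = 0" "C d * f4 - C l * f2 - C m * f3 = 0"
    using zero[of "C c * f4 - C k * f1 - C m * f3" "C d * f4 - C l * f2 - C m * f3"] f
    by (blast intro: piece_diff piece_C_mult)+
  then have e: "C c * f4 = C k * f1 + C m * f3" "C d * f4 = C l * f2 + C m * f3"
    by (simp_all add: algebra_simps)
  \<comment> \<open>Eliminating f4 from its two expressions leaves f3 with the factor (c - d)
    m.\<close>
  have "C d * (C c * f4) = C c * (C d * f4)" by (rule mult.left_commute)
  then have e2: "C ((c - d) * m) * f3 = C (d * k) * f1 + C (- (c * l)) * f2"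
    unfolding e by (simp add: C_mult single_diff single_uminus algebra_simps)
  have m: "m \<noteq> 0"
  proof
    assume "m = 0"
    then have "C (d * k) * f1 + C (- (c * l)) * f2 = 0" using e2 by simp
    then have "d * k = 0" using indep2D[OF indf] by blast
    then have "C c * f4 = 0" using e(1) cd \<open>m = 0\<close> by simp
    then show False using cd f0 by (simp add: C_eq_0_iff)
  qed
  define i where "i = inverse ((c - d) * m)"
  have "f3 = C i * (C (d * k) * f1 + C (- (c * l)) * f2)"
    unfolding e2[symmetric] i_def using m cd by (intro C_inverse_mult[symmetric]) simp
  then have f3: "f3 = C (i * (d * k)) * f1 + C (i * (- (c * l))) * f2"
    by (simp only: distrib_left C_mult_C)
  have g12: "indep2 g2 (g1 + g2)" "indep2 g1 (g1 + g2)"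
  proof -
    have "C a * g2 + C b * (g1 + g2) = C b * g1 + C (a + b) * g2"
      "C a * g1 + C b * (g1 + g2) = C (a + b) * g1 + C b * g2" for a b
      by (simp_all add: single_add algebra_simps)
    then show "indep2 g2 (g1 + g2)" "indep2 g1 (g1 + g2)"
      using ind unfolding indep2_def by (metis add.right_neutral add_0)+
  qed
  \<comment> \<open>Were \<mu> or \<nu> zero, f3 would be proportional to f2 or f1, again a common
    factor of two members of the net.\<close>
  have scaled: False if "f3 = C r * f'" "f' \<in> piece 2 0" "indep2 g' (g1 + g2)" "f' * g' \<in> net" for r f' g'
  proof -
    have "r \<noteq> 0" using that(1) f0(3) by auto
    have "C (inverse r) * (f3 * (g1 + g2)) \<in> net" by (rule kspan_C_mult[OF mem(3)])
    moreover have "C (inverse r) * (f3 * (g1 + g2)) = f' * (g1 + g2)"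
      unfolding that(1) mult.assoc by (rule C_inverse_mult[OF \<open>r \<noteq> 0\<close>])
    moreover have "f' \<noteq> 0" using that(1) f0(3) by auto
    ultimately show False using no_fixed_quadric[OF that(2) _ that(3,4)] by simp
  qed
  show ?thesis
  proof (rule that[OF _ _ f3 ind3 net])
    show "i * (d * k) \<noteq> 0"
      using scaled[of "i * (- (c * l))" f2 g2] f3 f(2) g12(1) mem(2) by auto
    show "i * (- (c * l)) \<noteq> 0"
      using scaled[of "i * (d * k)" f1 g1] f3 f(1) g12(2) mem(1) by auto
  qed
qed

text \<open>
  If \<open>U + V T = (\<alpha> + \<gamma> T) u + (\<beta> + \<delta> T) v\<close> and \<open>g\<^sub>1 + g\<^sub>2 T = (\<alpha> + \<gamma> T) z + (\<beta> + \<delta> T) w\<close>, then the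
  coefficients of the product lie in the span of \<open>u z\<close>, \<open>u w + v z\<close> and \<open>v w\<close>.
\<close>

lemma net_normal_form:
  assumes UV: "U \<in> piece 2 0" "V \<in> piece 2 0" and g: "g1 \<in> piece 0 1" "g2 \<in> piece 0 1"
    and ind: "indep2 g1 g2"
  obtains u v where "u \<in> piece 2 0" "v \<in> piece 2 0"
    "{U * g1, V * g2, U * g2 + V * g1} \<subseteq> kspan {u * Z, u * W + v * Z, v * W}"
proof -
  obtain \<alpha> \<beta> where g1: "g1 = C \<alpha> * Z + C \<beta> * W" by (rule piece_0_1_cases[OF g(1)])
  obtain \<gamma> \<delta> where g2: "g2 = C \<gamma> * Z + C \<delta> * W" by (rule piece_0_1_cases[OF g(2)])
  define d where "d = \<alpha> * \<delta> - \<gamma> * \<beta>"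
  have d: "d \<noteq> 0" using det_nonzero ind unfolding g1 g2 d_def .
  \<comment> \<open>u and v solve U = \<alpha> u + \<beta> v, V = \<gamma> u + \<delta> v by
    Cramer's rule.\<close>
  define u where "u = C (inverse d) * (C \<delta> * U - C \<beta> * V)"
  define v where "v = C (inverse d) * (C \<alpha> * V - C \<gamma> * U)"
  have uv: "u \<in> piece 2 0" "v \<in> piece 2 0"
    unfolding u_def v_def using UV by (blast intro: piece_diff piece_C_mult)+
  have Cd: "C d = C \<alpha> * C \<delta> - C \<gamma> * C \<beta>" by (simp add: d_def single_diff C_mult)
  have "C \<alpha> * u + C \<beta> * v = C (inverse d) * (C d * U)" "C \<gamma> * u + C \<delta> * v = C (inverse d) * (C d * V)"
    unfolding u_def v_def Cd by (simp_all add: algebra_simps)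
  then have U: "U = C \<alpha> * u + C \<beta> * v" and V: "V = C \<gamma> * u + C \<delta> * v"
    by (simp_all add: C_inverse_mult[OF d])
  have "U * g1 = C (\<alpha> * \<alpha>) * (u * Z) + C (\<alpha> * \<beta>) * (u * W + v * Z) + C (\<beta> * \<beta>) * (v * W)"
    "V * g2 = C (\<gamma> * \<gamma>) * (u * Z) + C (\<gamma> * \<delta>) * (u * W + v * Z) + C (\<delta> * \<delta>) * (v * W)"
    "U * g2 + V * g1 = C (\<alpha> * \<gamma> + \<alpha> * \<gamma>) * (u * Z) + C (\<alpha> * \<delta> + \<beta> * \<gamma>) * (u * W + v * Z)
      + C (\<beta> * \<delta> + \<beta> * \<delta>) * (v * W)"
    unfolding U V g1 g2 by (simp_all add: C_mult single_add algebra_simps)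
  then have "{U * g1, V * g2, U * g2 + V * g1} \<subseteq> kspan {u * Z, u * W + v * Z, v * W}"
    unfolding kspan_triple subset_iff by blast
  with uv show ?thesis by (rule that)
qed

lemma segre_points:
  assumes "E \<in> proj net \<inter> segre_image"
  obtains f g where "E = kspan {f * g}" "f \<in> piece 2 0" "f \<noteq> 0" "g \<in> piece 0 1" "g \<noteq> 0" "f * g \<in> net"
proof -
  obtain f g where fg: "E = kspan {f * g}" "f \<in> piece 2 0" "f \<noteq> 0" "g \<in> piece 0 1" "g \<noteq> 0"
    using assms by (auto simp: segre_image_def)
  obtain p where p: "E = kspan {p}" "p \<in> net" using assms by (auto simp: proj_def)
  have "f * g \<in> kspan {p}" using fg(1) p(1) kspan_base[of "f * g" "{f * g}"] by simp
  also have "\<dots> \<subseteq> net" using p(2) by (intro kspan_subset) simp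
  finally show ?thesis using fg that by blast
qed

lemma nongeneric_net:
  assumes "nongeneric p0 p1 p2"
  obtains u v where "coprime_quadrics u v" "net = kspan {u * Z, u * W + v * Z, v * W}"
proof -
  define S where "S = proj net \<inter> segre_image"
  have inf: "infinite S" using assms by (simp add: S_def nongeneric_def)
  have ex: "\<exists>E. E \<in> S - T" if "finite T" for T
    using Diff_infinite_finite[OF that inf] by (metis ex_in_conv finite.emptyI)
  obtain E1 where E1: "E1 \<in> S" using ex[of "{}"] by auto
  obtain E2 where E2: "E2 \<in> S" "E2 \<noteq> E1" using ex[of "{E1}"] by auto
  obtain E3 where E3: "E3 \<in> S" "E3 \<noteq> E1" "E3 \<noteq> E2" using ex[of "{E1, E2}"] by auto
  obtain E4 where E4: "E4 \<in> S" "E4 \<noteq> E1" "E4 \<noteq> E2" "E4 \<noteq> E3" using ex[of "{E1, E2, E3}"] by auto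
  obtain f1 g1 where 1: "E1 = kspan {f1 * g1}" "f1 \<in> piece 2 0" "f1 \<noteq> 0" "g1 \<in> piece 0 1" "g1 \<noteq> 0" "f1 * g1 \<in> net"
    using segre_points E1 unfolding S_def by blast
  obtain f2 g2 where 2: "E2 = kspan {f2 * g2}" "f2 \<in> piece 2 0" "f2 \<noteq> 0" "g2 \<in> piece 0 1" "g2 \<noteq> 0" "f2 * g2 \<in> net"
    using segre_points E2(1) unfolding S_def by blast
  obtain f3 g3 where 3: "E3 = kspan {f3 * g3}" "f3 \<in> piece 2 0" "f3 \<noteq> 0" "g3 \<in> piece 0 1" "g3 \<noteq> 0" "f3 * g3 \<in> net"
    using segre_points E3(1) unfolding S_def by blast
  obtain f4 g4 where 4: "E4 = kspan {f4 * g4}" "f4 \<in> piece 2 0" "f4 \<noteq> 0" "g4 \<in> piece 0 1" "g4 \<noteq> 0" "f4 * g4 \<in> net"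
    using segre_points E4(1) unfolding S_def by blast
  have i12: "indep2 g1 g2" using distinct_points_indep[of f1 f2 g1 g2] 1 2 E2 by simp
  have i13: "indep2 g1 g3" using distinct_points_indep[of f1 f3 g1 g3] 1 3 E3 by simp
  have i23: "indep2 g2 g3" using distinct_points_indep[of f2 f3 g2 g3] 2 3 E3 by simp
  have i14: "indep2 g1 g4" using distinct_points_indep[of f1 f4 g1 g4] 1 4 E4 by simp
  have i24: "indep2 g2 g4" using distinct_points_indep[of f2 f4 g2 g4] 2 4 E4 by simp
  have i34: "indep2 g3 g4" using distinct_points_indep[of f3 f4 g3 g4] 3 4 E4 by simp
  obtain a b where g3: "g3 = C a * g1 + C b * g2" using linear_combination[OF i12] 1 2 3 by blast
  have a: "a \<noteq> 0" using indep2D[OF i23, of b "-1"] by (auto simp: g3 single_uminus)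
  have b: "b \<noteq> 0" using indep2D[OF i13, of a "-1"] by (auto simp: g3 single_uminus)
  \<comment> \<open>After this scaling g3 is the plain sum of the two forms.\<close>
  let ?g1 = "C a * g1" and ?g2 = "C b * g2"
  have scale: "C k * x + C l * y = C (k / a) * (C a * x) + C (l / b) * (C b * y)" for k l x y
    using a b by (simp add: C_mult_C)
  have i12': "indep2 ?g1 ?g2"
    using i12 a b unfolding indep2_def C_mult_C by (metis mult_eq_0_iff)
  have pg: "?g1 \<in> piece 0 1" "?g2 \<in> piece 0 1" using 1 2 by (blast intro: piece_C_mult)+
  obtain k l where "g4 = C k * g1 + C l * g2" using linear_combination[OF i12] 1 2 4 by blast
  then obtain c d where g4: "g4 = C c * ?g1 + C d * ?g2" using scale by blast
  \<comment> \<open>The three conditions say that g4 is proportional to none of g2, g1, g3.\<close>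
  have c: "c \<noteq> 0" using indep2D[OF i24, of "d * b" "-1"] by (auto simp: g4 single_uminus C_mult_C)
  have d: "d \<noteq> 0" using indep2D[OF i14, of "c * a" "-1"] by (auto simp: g4 single_uminus C_mult_C)
  have cd: "c \<noteq> d" using indep2D[OF i34, of c "-1"] by (auto simp: g3 g4 single_uminus algebra_simps)
  have mem: "f1 * ?g1 \<in> net" "f2 * ?g2 \<in> net"
    using kspan_C_mult[OF 1(6), of a] kspan_C_mult[OF 2(6), of b] by (simp_all add: algebra_simps)
  obtain \<mu> \<nu> where mn: "\<mu> \<noteq> 0" "\<nu> \<noteq> 0" and f3: "f3 = C \<mu> * f1 + C \<nu> * f2"
    and ind3: "indep3 (f1 * ?g1) (f2 * ?g2) (f3 * (?g1 + ?g2))"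
    and net: "net = kspan {f1 * ?g1, f2 * ?g2, f3 * (?g1 + ?g2)}"
    by (rule net_spanned_by_conic[OF 1(2) 2(2) 3(2) 4(2) 1(3) 2(3) 3(3) 4(3) pg i12' mem
        3(6)[unfolded g3] 4(6)[unfolded g4] c d cd])
  let ?U = "C \<mu> * f1" and ?V = "C \<nu> * f2"
  have UV: "?U \<in> piece 2 0" "?V \<in> piece 2 0" using 1 2 by (blast intro: piece_C_mult)+
  obtain u v where uv: "u \<in> piece 2 0" "v \<in> piece 2 0"
    and sub: "{?U * ?g1, ?V * ?g2, ?U * ?g2 + ?V * ?g1} \<subseteq> kspan {u * Z, u * W + v * Z, v * W}"
    by (rule net_normal_form[OF UV pg i12'])
  let ?N = "kspan {u * Z, u * W + v * Z, v * W}"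
  have "f1 * ?g1 = C (inverse \<mu>) * (?U * ?g1)" "f2 * ?g2 = C (inverse \<nu>) * (?V * ?g2)"
    unfolding mult.assoc by (simp_all add: C_inverse_mult[OF mn(1)] C_inverse_mult[OF mn(2)])
  then have "f1 * ?g1 \<in> ?N" "f2 * ?g2 \<in> ?N" using sub kspan_C_mult by (metis insert_subset)+
  moreover have "f3 * (?g1 + ?g2) = ?U * ?g1 + ?V * ?g2 + (?U * ?g2 + ?V * ?g1)"
    unfolding f3 by (simp add: algebra_simps)
  then have "f3 * (?g1 + ?g2) \<in> ?N" using sub by (simp only: insert_subset kspan_add)
  \<comment> \<open>Three independent members of the net lie in \<open>?N\<close>, a span of three
    elements, and therefore fill it.\<close>
  ultimately have N: "net = ?N"
    unfolding net by (intro kspan_triple_eq[OF ind3, symmetric]) simp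
  have "coprime_quadrics u v"
  proof (unfold_locales, fact uv(1), fact uv(2))
    fix s t :: "'k \<times> 'k" assume s: "s \<noteq> (0, 0)"
    \<comment> \<open>A common zero of u and v on the first factor would be a base point together
      with any t; (1, 1) is one choice.\<close>
    have "{p0, p1, p2} \<subseteq> ?N" using kspan_superset[of "{p0, p1, p2}"] N by simp
    then obtain y where "y \<in> {u * Z, u * W + v * Z, v * W}" "eval_at y s (1, 1) \<noteq> 0"
      using no_base_point[OF _ s, of _ "(1, 1)"] by auto
    then have "eval_at u s (1, 1) \<noteq> 0 \<or> eval_at v s (1, 1) \<noteq> 0" by (auto simp: eval_at_simps)
    then show "eval_at u s t \<noteq> 0 \<or> eval_at v s t \<noteq> 0"
      using eval_at_piece_2_0[OF uv(1), of s t "(1, 1)"] eval_at_piece_2_0[OF uv(2), of s t "(1, 1)"] by simp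
  qed
  with N show ?thesis using that by blast
qed

end

theorem theorem7p8:
  fixes p0 p1 p2 :: "('k::alg_closed_field) bipoly"
  assumes "p0 \<in> piece 2 1" and "p1 \<in> piece 2 1" and "p2 \<in> piece 2 1"
    and "no_common_zeros {p0, p1, p2}"
    and "nongeneric p0 p1 p2"
  shows "\<exists>aug d. minimal_bigraded_free_resolution (ideal_gen {p0, p1, p2})
    [replicate 3 (-2, -1),
     [(-6, -1)] @ replicate 3 (-4, -2) @ [(-2, -3)],
     replicate 2 (-4, -3) @ replicate 2 (-6, -2),
     [(-6, -3)]]
    aug d"
proof -
  interpret base_point_free_net p0 p1 p2 using assms by unfold_locales
  obtain u v where uv: "coprime_quadrics u v" "net = kspan {u * Z, u * W + v * Z, v * W}"
    by (rule nongeneric_net[OF assms(5)])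
  \<comment> \<open>The ideal depends only on the k-span of its generators, so passing to the normal
    form leaves I unchanged.\<close>
  have "ideal_gen {p0, p1, p2} = ideal_gen {u * Z, u * W + v * Z, v * W}"
    using uv(2) by (intro equalityI ideal_gen_kspan) simp_all
  then show ?thesis using coprime_quadrics.resolution[OF uv(1)] by simp
qed

end
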